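(* Let $n\ge1$ and $0\le r\le n$ be integers and let $\Lambda\in M_n(k^* )$ be multiplicatively antisymmetric. The centre of the skew field $\operatorname{Frac}(S_{n,r}^{\Lambda}(k))$ is the intersection of the centre of the sub-skew-field generated by $y_1,\dots,y_n$ with the sub-skew-field generated by $y_{r+1},\dots,y_n$: $$\mathcal Z(\operatorname{Frac}(S_{n,r}^{\Lambda}(k)))=\mathcal Z(k_{\Lambda}(y_1,\dots,y_n))\cap k_{\widetilde\Lambda}(y_{r+1},\dots,y_n),$$ where $\widetilde\Lambda$ is the matrix obtained from $\Lambda$ by deleting the first $r$ rows and columns.
   Context: $k$ is a field of characteristic $0$; $\mathcal Z(A)$ denotes the centre of $A$. A matrix $\Lambda=(\lambda_{i,j})\in M_n(k^* )$ is multiplicatively antisymmetric if $\lambda_{i,j}\lambda_{j,i}=\lambda_{i,i}=1$ for all $i,j$. For integers $n\ge1$, $0\le r\le n$ and such a $\Lambda$, $S_{n,r}^{\Lambda}(k)$ is the $k$-algebra generated by $y_1,\dots,y_n,x_1,\dots,x_r$ with relations: $y_iy_j=\lambda_{i,j}y_jy_i$ ($1\le i,j\le n$); $x_iy_i=y_ix_i+1$ ($1\le i\le r$); $x_iy_j=\lambda_{i,j}^{-1}y_jx_i$ ($1\le i\le r$, $1\le j\le n$, $i\ne j$); $x_ix_j=\lambda_{i,j}x_jx_i$ ($1\le i,j\le r$). It is a noetherian domain (an iterated Ore extension) and $\operatorname{Frac}$ denotes its skew field of fractions. $k_\Lambda(y_1,\dots,y_n)$ denotes the skew field of fractions of the quantum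 affine space $k_\Lambda[y_1,\dots,y_n]$, the $k$-algebra generated by $y_1,\dots,y_n$ with relations $y_iy_j=\lambda_{i,j}y_jy_i$; it is identified with the sub-skew-field of $\operatorname{Frac}(S_{n,r}^{\Lambda}(k))$ generated by $y_1,\dots,y_n$, and similarly for $k_{\widetilde\Lambda}(y_{r+1},\dots,y_n)$. *)

theory Defs
  imports "HOL-Library.Poly_Mapping" "HOL-Algebra.Algebraic_Closure_Type"
begin

text \<open>
  Words form the free monoid under concatenation, so that \<^typ>\<open>'g list \<Rightarrow>\<^sub>0 'k\<close> with the
  convolution product of \<^theory>\<open>HOL-Library.Poly_Mapping\<close> is the free associative
  \<open>'k\<close>-algebra on all of \<open>'g\<close>.
\<close>

instantiation list :: (type) monoid_add
begin

definition zero_list :: "'a list" where "zero_list = []"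

definition plus_list :: "'a list \<Rightarrow> 'a list \<Rightarrow> 'a list" where "plus_list xs ys = xs @ ys"

instance by standard (simp_all add: zero_list_def plus_list_def)

end

definition free_algebra :: "'g set \<Rightarrow> ('g list \<Rightarrow>\<^sub>0 'k::field) ring" where
  "free_algebra G = ring_of_type_algebra\<lparr>carrier := {p. \<forall>w \<in> Poly_Mapping.keys p. set w \<subseteq> G}\<rparr>"

definition scalar :: "'k \<Rightarrow> ('g list \<Rightarrow>\<^sub>0 'k::field)" where
  "scalar c = Poly_Mapping.single [] c"

definition letter :: "'g \<Rightarrow> ('g list \<Rightarrow>\<^sub>0 'k::field)" where
  "letter g = Poly_Mapping.single [g] 1"

datatype weyl_gen = GenY nat | GenX nat

abbreviation gen_y :: "nat \<Rightarrow> (weyl_gen list \<Rightarrow>\<^sub>0 'k::field)" where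
  "gen_y i \<equiv> letter (GenY i)"

abbreviation gen_x :: "nat \<Rightarrow> (weyl_gen list \<Rightarrow>\<^sub>0 'k::field)" where
  "gen_x i \<equiv> letter (GenX i)"

text \<open>
  A matrix \<open>\<Lambda> \<in> M\<^sub>n(k)\<close> is a function of which only the values at \<open>i, j \<in> {1..n}\<close> matter. That these
  entries are nonzero is part of the condition \<open>\<Lambda> i j * \<Lambda> j i = 1\<close>.
\<close>

definition mult_antisymmetric :: "nat \<Rightarrow> (nat \<Rightarrow> nat \<Rightarrow> 'k::field) \<Rightarrow> bool" where
  "mult_antisymmetric n \<Lambda> \<longleftrightarrow>
     (\<forall>i \<in> {1..n}. \<forall>j \<in> {1..n}. \<Lambda> i j * \<Lambda> j i = 1 \<and> \<Lambda> i i = 1)"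

definition weyl_gens :: "nat \<Rightarrow> nat \<Rightarrow> weyl_gen set" where
  "weyl_gens n r = GenY ` {1..n} \<union> GenX ` {1..r}"

definition weyl_relators ::
    "nat \<Rightarrow> nat \<Rightarrow> (nat \<Rightarrow> nat \<Rightarrow> 'k::field) \<Rightarrow> (weyl_gen list \<Rightarrow>\<^sub>0 'k) set" where
  "weyl_relators n r \<Lambda> =
     {gen_y i * gen_y j - scalar (\<Lambda> i j) * gen_y j * gen_y i | i j. i \<in> {1..n} \<and> j \<in> {1..n}}
   \<union> {gen_x i * gen_y i - (gen_y i * gen_x i + 1) | i. i \<in> {1..r}}
   \<union> {gen_x i * gen_y j - scalar (inverse (\<Lambda> i j)) * gen_y j * gen_x i | i j.
        i \<in> {1..r} \<and> j \<in> {1..n} \<and> i \<noteq> j}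
   \<union> {gen_x i * gen_x j - scalar (\<Lambda> i j) * gen_x j * gen_x i | i j. i \<in> {1..r} \<and> j \<in> {1..r}}"

definition weyl_ideal ::
    "nat \<Rightarrow> nat \<Rightarrow> (nat \<Rightarrow> nat \<Rightarrow> 'k::field) \<Rightarrow> (weyl_gen list \<Rightarrow>\<^sub>0 'k) set" where
  "weyl_ideal n r \<Lambda> = Idl\<^bsub>free_algebra (weyl_gens n r)\<^esub> (weyl_relators n r \<Lambda>)"

text \<open>The algebra \<open>S\<^sub>n\<^sub>,\<^sub>r\<close> attached to \<open>\<Lambda>\<close>, and the class in it of an element of the free algebra.\<close>

definition weyl_algebra ::
    "nat \<Rightarrow> nat \<Rightarrow> (nat \<Rightarrow> nat \<Rightarrow> 'k::field) \<Rightarrow> (weyl_gen list \<Rightarrow>\<^sub>0 'k) set ring" where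
  "weyl_algebra n r \<Lambda> = free_algebra (weyl_gens n r) Quot weyl_ideal n r \<Lambda>"

definition weyl_class ::
    "nat \<Rightarrow> nat \<Rightarrow> (nat \<Rightarrow> nat \<Rightarrow> 'k::field) \<Rightarrow> (weyl_gen list \<Rightarrow>\<^sub>0 'k)
       \<Rightarrow> (weyl_gen list \<Rightarrow>\<^sub>0 'k) set" where
  "weyl_class n r \<Lambda> p = weyl_ideal n r \<Lambda> +>\<^bsub>free_algebra (weyl_gens n r)\<^esub> p"

text \<open>
  The skew field \<open>'d\<close> together with \<open>\<phi>\<close> is a skew field of (right) fractions of \<open>R\<close>. For an Ore domain
  this determines \<open>('d, \<phi>)\<close> up to a unique isomorphism under \<open>R\<close>, and for a noetherian domain right
  and left fractions give the same skew field.
\<close>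

definition skew_field_of_fractions :: "('a, 'b) ring_scheme \<Rightarrow> ('a \<Rightarrow> 'd::division_ring) \<Rightarrow> bool" where
  "skew_field_of_fractions R \<phi> \<longleftrightarrow>
     \<phi> \<in> ring_hom R ring_of_type_algebra \<and> inj_on \<phi> (carrier R) \<and>
     (\<forall>d. \<exists>a \<in> carrier R. \<exists>s \<in> carrier R - {\<zero>\<^bsub>R\<^esub>}. d = \<phi> a * inverse (\<phi> s))"

text \<open>Since \<open>inverse 0 = 0\<close>, closure under inverses need not exclude \<open>0\<close>.\<close>

definition sub_skew_field :: "'d::division_ring set \<Rightarrow> bool" where
  "sub_skew_field K \<longleftrightarrow>
     1 \<in> K \<and> (\<forall>a \<in> K. \<forall>b \<in> K. a - b \<in> K \<and> a * b \<in> K) \<and> (\<forall>a \<in> K. inverse a \<in> K)"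

definition centre :: "'d::division_ring set \<Rightarrow> 'd set" where
  "centre K = {z \<in> K. \<forall>a \<in> K. z * a = a * z}"

text \<open>
  The sub-skew-field of the fractions generated over \<open>k\<close> by the \<open>y\<^sub>j\<close> with \<open>j \<in> J\<close>. The image of \<open>k\<close>
  is put in explicitly: skew fields of fractions of \<open>k\<close>-algebras contain \<open>k\<close>, and for \<open>J = {}\<close>
  the result is \<open>k\<close> and not the prime field.
\<close>

definition y_subfield ::
    "nat \<Rightarrow> nat \<Rightarrow> (nat \<Rightarrow> nat \<Rightarrow> 'k::field) \<Rightarrow> ((weyl_gen list \<Rightarrow>\<^sub>0 'k) set \<Rightarrow> 'd::division_ring)
       \<Rightarrow> nat set \<Rightarrow> 'd set" where
  "y_subfield n r \<Lambda> \<phi> J = sub_skew_field hull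
     (range (\<lambda>c. \<phi> (weyl_class n r \<Lambda> (scalar c))) \<union> (\<lambda>j. \<phi> (weyl_class n r \<Lambda> (gen_y j))) ` J)"

lemma carrier_free_algebra:
  "carrier (free_algebra G) = {p. \<forall>w \<in> Poly_Mapping.keys p. set w \<subseteq> G}"
  by (simp add: free_algebra_def)

lemma free_algebra_simps [simp]:
  "monoid.mult (free_algebra G) = (*)" "monoid.one (free_algebra G) = 1"
  "ring.zero (free_algebra G) = 0" "ring.add (free_algebra G) = (+)"
  by (auto simp: free_algebra_def ring_of_type_algebra_def)

lemma free_algebra_closed:
  assumes "p \<in> carrier (free_algebra G)" "q \<in> carrier (free_algebra G)"
  shows "p + q \<in> carrier (free_algebra G)" "- p \<in> carrier (free_algebra G)"
    "p - q \<in> carrier (free_algebra G)" "p * q \<in> carrier (free_algebra G)"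
proof -
  show add: "p + q \<in> carrier (free_algebra G)"
    using assms keys_add[of p q] by (auto simp: carrier_free_algebra)
  show "- p \<in> carrier (free_algebra G)"
    using assms by (auto simp: carrier_free_algebra)
  show "p - q \<in> carrier (free_algebra G)"
    using assms keys_add[of p "- q"] by (auto simp: carrier_free_algebra)
  show "p * q \<in> carrier (free_algebra G)"
    using assms keys_mult[of p q]
    by (fastforce simp: carrier_free_algebra plus_list_def)
qed

lemma scalar_in_free_algebra: "scalar c \<in> carrier (free_algebra G)"
  by (simp add: carrier_free_algebra scalar_def)

lemma letter_in_free_algebra: "g \<in> G \<Longrightarrow> letter g \<in> carrier (free_algebra G)"
  by (simp add: carrier_free_algebra letter_def)

lemma scalar_1: "scalar 1 = 1"
  by (simp add: scalar_def flip: zero_list_def)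

lemma one_in_free_algebra: "1 \<in> carrier (free_algebra G)"
  using scalar_in_free_algebra[of 1] by (simp add: scalar_1)

lemma ring_free_algebra: "ring (free_algebra G :: ('g list \<Rightarrow>\<^sub>0 'k::field) ring)"
proof (rule ringI)
  show "abelian_group (free_algebra G :: ('g list \<Rightarrow>\<^sub>0 'k::field) ring)"
  proof (rule abelian_groupI)
    fix p :: "'g list \<Rightarrow>\<^sub>0 'k" assume "p \<in> carrier (free_algebra G)"
    then show "\<exists>q \<in> carrier (free_algebra G). q \<oplus>\<^bsub>free_algebra G\<^esub> p = \<zero>\<^bsub>free_algebra G\<^esub>"
      by (intro bexI[of _ "- p"]) (auto intro: free_algebra_closed)
  qed (auto intro: free_algebra_closed simp: add.assoc add.commute carrier_free_algebra[THEN eqset_imp_iff, of 0])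
  show "monoid (free_algebra G :: ('g list \<Rightarrow>\<^sub>0 'k::field) ring)"
    by (rule monoidI) (auto intro: free_algebra_closed one_in_free_algebra simp: mult.assoc)
qed (auto simp: algebra_simps)

lemma weyl_relators_in_free_algebra:
  assumes "r \<le> n"
  shows "weyl_relators n r \<Lambda> \<subseteq> carrier (free_algebra (weyl_gens n r))"
  using assms unfolding weyl_relators_def
  by (auto simp: weyl_gens_def
      intro!: free_algebra_closed scalar_in_free_algebra letter_in_free_algebra one_in_free_algebra)

lemma ideal_weyl_ideal: "r \<le> n \<Longrightarrow> ideal (weyl_ideal n r \<Lambda>) (free_algebra (weyl_gens n r))"
  unfolding weyl_ideal_def
  by (intro ring.genideal_ideal ring_free_algebra weyl_relators_in_free_algebra)

lemma ring_weyl_algebra: "r \<le> n \<Longrightarrow> ring (weyl_algebra n r \<Lambda>)"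
  unfolding weyl_algebra_def by (intro ideal.quotient_is_ring ideal_weyl_ideal)

lemma sub_skew_field_hull: "sub_skew_field (sub_skew_field hull H)"
  by (rule hull_in) (auto simp: sub_skew_field_def)

end

(*
  Put w_i = y_i x_i. On the ordered monomials y^a x^b, exchanging the side of a factor y_i is a scalar
  up to terms of smaller degree in the x_j, and the commutator with w_i is exactly diagonal. These
  monomials form a basis of S: let S act on functions on Z^n, y_i by a twisted shift Y_i and x_i by
  Y_i^(-1) W_i, where W_i multiplies by the i-th coordinate; in characteristic 0 the monomials are
  triangular with respect to suitable indicator functions.

  For a central z, the s in S with z s in S form a nonzero two-sided ideal. An element f of the
  ideal that minimises first the x-degree and then the number of terms of top x-degree is a
  simultaneous twisted eigenvector for y_i and w_i, i <= r: otherwise subtracting the eigenvalue of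
  a top term gives a smaller element. As z is central, z f satisfies the same equations. Comparing
  coefficients (characteristic 0 again) shows that such an eigenvector contains no x_j and has the
  same exponents of y_1, ..., y_r in all its terms. Hence f = y^d f' and z f = y^d g' with f', g' in
  the algebra generated by y_(r+1), ..., y_n, so that z = g' f'^(-1).
*)
theory Submission
  imports Defs
begin

subsection \<open>Ordered monomials\<close>

text \<open>The overview leaves out the inclusion from right to left. Since w_i commutes with y_j
  for j \<noteq> i, it commutes with every z in the skew field generated by y_(r+1), ..., y_n. If z
  also commutes with y_i, cancelling y_i shows that it commutes with x_i. In the other direction the
  obstacle is that f y_i - c y_i f raises the degree in the y_j, so no finite-dimensional invariant
  space is at hand in which to look for eigenvectors. Counting terms of top x-degree succeeds
  because y_i merely translates the exponents of the top terms: once one of them is killed, the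
  count drops. A single minimal f works for every i, so the operators need not be diagonalised one
  after the other. The representation comes from left multiplication on formal Laurent sums in y_1,
  ..., y_n; the operator for x_i is then forced by requiring y_i x_i to act as W_i. It serves only
  to show that the defining ideal contains no nontrivial combination of ordered monomials; all other
  computations take place inside the division ring of fractions.\<close>

primrec ordered_monomial :: "(nat \<Rightarrow> 'a::monoid_mult) \<Rightarrow> nat \<Rightarrow> (nat \<Rightarrow> nat) \<Rightarrow> 'a" where
  "ordered_monomial g 0 a = 1"
| "ordered_monomial g (Suc N) a = ordered_monomial g N a * g (Suc N) ^ a (Suc N)"

lemma ordered_monomial_cong:
  "(\<And>j. j \<in> {1..N} \<Longrightarrow> a j = b j) \<Longrightarrow> ordered_monomial g N a = ordered_monomial g N b"
  by (induction N) auto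

lemma ordered_monomial_zero [simp]: "ordered_monomial g N (\<lambda>_. 0) = 1"
  by (induction N) auto

lemma ordered_monomial_split:
  assumes "r \<le> N"
  shows "ordered_monomial g N a =
    ordered_monomial g r a * ordered_monomial g N (\<lambda>j. if j \<le> r then 0 else a j)"
  using assms
proof (induction N)
  case (Suc N)
  then show ?case
  proof (cases "r = Suc N")
    case True
    have "ordered_monomial g (Suc N) (\<lambda>j. if j \<le> Suc N then 0 else a j)
      = ordered_monomial g (Suc N) (\<lambda>_. 0)"
      by (rule ordered_monomial_cong) auto
    then show ?thesis using True by simp
  qed (auto simp: mult.assoc)
qed auto

text \<open>The commutator with \<open>w\<close> is a derivation having each \<open>g j\<close> as
  an eigenvector, so the eigenvalues add up along a product.\<close>

lemma ordered_monomial_commutator: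
  fixes w :: "'a::ring_1"
  assumes "\<And>j. j \<in> {1..N} \<Longrightarrow> w * g j = g j * w + of_int (\<delta> j) * g j"
  shows "w * ordered_monomial g N a
    = ordered_monomial g N a * w + of_int (\<Sum>j=1..N. \<delta> j * int (a j)) * ordered_monomial g N a"
  using assms
proof (induction N)
  case (Suc N)
  let ?g = "g (Suc N)" and ?M = "ordered_monomial g N a"
  have pow: "w * ?g ^ k = ?g ^ k * w + of_int (\<delta> (Suc N) * int k) * ?g ^ k" for k
  proof (induction k)
    case (Suc k)
    have "w * ?g ^ Suc k = (w * ?g ^ k) * ?g" by (simp add: power_commutes mult.assoc)
    also have "\<dots> = ?g ^ k * (w * ?g) + of_int (\<delta> (Suc N) * int k) * ?g ^ Suc k"
      by (simp add: Suc algebra_simps power_commutes)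
    also have "w * ?g = ?g * w + of_int (\<delta> (Suc N)) * ?g" using Suc.prems \<open>\<And>j. j \<in> {1..Suc N} \<Longrightarrow> _\<close> by simp
    also have "?g ^ k * (?g * w + of_int (\<delta> (Suc N)) * ?g) =
      ?g ^ Suc k * w + of_int (\<delta> (Suc N)) * ?g ^ Suc k"
      by (metis (no_types, lifting) distrib_left mult.assoc mult_of_int_commute power_Suc2)
    finally show ?case by (simp add: algebra_simps)
  qed simp
  have "w * ordered_monomial g (Suc N) a = (w * ?M) * ?g ^ a (Suc N)" by (simp add: mult.assoc)
  also have "\<dots> = ?M * (w * ?g ^ a (Suc N))
      + of_int (\<Sum>j=1..N. \<delta> j * int (a j)) * ordered_monomial g (Suc N) a"
    using Suc by (simp add: distrib_right mult.assoc)
  also have "?M * (w * ?g ^ a (Suc N)) = ordered_monomial g (Suc N) a * w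
      + of_int (\<delta> (Suc N) * int (a (Suc N))) * ordered_monomial g (Suc N) a"
    unfolding pow by (metis (no_types, lifting) distrib_left mult.assoc mult_of_int_commute
      ordered_monomial.simps(2))
  finally show ?case by (simp add: distrib_right add.assoc add.commute add.left_commute)
qed simp

text \<open>Encodes a division ring over a central copy of k. The field is a separate type, so it
  enters as a scalar action, which makes \<open>span\<close> and \<open>representation\<close>
  available.\<close>

locale skew_field_algebra = vector_space scale
  for scale :: "'k::field_char_0 \<Rightarrow> 'd::division_ring \<Rightarrow> 'd" (infixr "*s" 75) +
  assumes scale_mult_left [simp]: "(c *s u) * v = c *s (u * v)"
    and scale_mult_right [simp]: "u * (c *s v) = c *s (u * v)"
begin

lemma of_nat_mult_eq_scale: "of_nat m * v = of_nat m *s v"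
  by (induction m) (simp_all add: distrib_right scale_left_distrib)

lemma of_int_mult_eq_scale: "of_int m * v = of_int m *s v"
  by (cases m rule: int_diff_cases) (simp add: left_diff_distrib scale_left_diff_distrib of_nat_mult_eq_scale)

lemma power_q_commute:
  assumes "g * t = q *s (t * g)"
  shows "g ^ k * t = q ^ k *s (t * g ^ k)"
proof (induction k)
  case (Suc k)
  have "g ^ Suc k * t = g * (g ^ k * t)" by (simp add: mult.assoc)
  also have "\<dots> = q ^ k *s ((g * t) * g ^ k)" by (simp add: Suc mult.assoc)
  also have "\<dots> = q ^ Suc k *s (t * g ^ Suc k)" by (simp add: assms mult.assoc mult.commute)
  finally show ?case .
qed simp

lemma ordered_monomial_q_commute:
  assumes "\<And>j. j \<in> {1..N} \<Longrightarrow> g j * t = q j *s (t * g j)"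
  shows "ordered_monomial g N a * t = (\<Prod>j=1..N. q j ^ a j) *s (t * ordered_monomial g N a)"
  using assms
proof (induction N)
  case (Suc N)
  have "ordered_monomial g (Suc N) a * t = ordered_monomial g N a * (g (Suc N) ^ a (Suc N) * t)"
    by (simp add: mult.assoc)
  also have "\<dots> = q (Suc N) ^ a (Suc N) *s ((ordered_monomial g N a * t) * g (Suc N) ^ a (Suc N))"
    by (subst power_q_commute[OF Suc.prems]) (simp_all add: mult.assoc)
  also have "\<dots> = (\<Prod>j=1..Suc N. q j ^ a j) *s (t * ordered_monomial g (Suc N) a)"
    using Suc by (simp add: mult.assoc mult.commute)
  finally show ?case .
qed simp

text \<open>\<open>g i\<close> travels left past \<open>g N\<close>, ..., \<open>g (i+1)\<close> and
  joins its own power; each crossing costs a nonzero scalar. Later arguments use only that the total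
  is nonzero, so it stays unspecified.\<close>

lemma ordered_monomial_mult_generator:
  assumes "\<And>j. j \<in> {1..N} \<Longrightarrow> g j * g i = q j *s (g i * g j)"
    and "\<And>j. j \<in> {1..N} \<Longrightarrow> q j \<noteq> 0" and "i \<in> {1..N}"
  shows "\<exists>c. c \<noteq> 0 \<and> ordered_monomial g N a * g i = c *s ordered_monomial g N (a(i := Suc (a i)))"
  using assms
proof (induction N)
  case (Suc N)
  show ?case
  proof (cases "i = Suc N")
    case True
    have "ordered_monomial g N (a(Suc N := Suc (a (Suc N)))) = ordered_monomial g N a"
      by (rule ordered_monomial_cong) auto
    then show ?thesis using True
      by (intro exI[of _ 1]) (simp del: fun_upd_apply add: mult.assoc power_commutes fun_upd_same)
  next
    case False
    then obtain c where c: "c \<noteq> 0"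
      "ordered_monomial g N a * g i = c *s ordered_monomial g N (a(i := Suc (a i)))"
      using Suc by fastforce
    have "ordered_monomial g (Suc N) a * g i
      = ordered_monomial g N a * (g (Suc N) ^ a (Suc N) * g i)" by (simp add: mult.assoc)
    also have "\<dots> = q (Suc N) ^ a (Suc N) *s ((ordered_monomial g N a * g i) * g (Suc N) ^ a (Suc N))"
      by (subst power_q_commute[OF Suc.prems(1)]) (simp_all add: mult.assoc)
    also have "\<dots> = (q (Suc N) ^ a (Suc N) * c) *s ordered_monomial g (Suc N) (a(i := Suc (a i)))"
      using False by (simp del: fun_upd_apply add: c fun_upd_other)
    finally have "ordered_monomial g (Suc N) a * g i
      = (q (Suc N) ^ a (Suc N) * c) *s ordered_monomial g (Suc N) (a(i := Suc (a i)))" .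
    moreover have "q (Suc N) ^ a (Suc N) * c \<noteq> 0" using c(1) Suc.prems(2)[of "Suc N"] by simp
    ultimately show ?thesis by blast
  qed
qed simp

text \<open>Moving \<open>g i\<close> across the whole monomial costs the invertible scalar
  \<open>e\<close>, which reduces this to multiplication on the right.\<close>

lemma generator_mult_ordered_monomial:
  assumes "\<And>j. j \<in> {1..N} \<Longrightarrow> g j * g i = q j *s (g i * g j)"
    and "\<And>j. j \<in> {1..N} \<Longrightarrow> q j \<noteq> 0" and "i \<in> {1..N}"
  shows "\<exists>c. c \<noteq> 0 \<and> g i * ordered_monomial g N a = c *s ordered_monomial g N (a(i := Suc (a i)))"
proof -
  define e where "e = (\<Prod>j=1..N. q j ^ a j)"
  have e: "e \<noteq> 0" using assms(2) by (auto simp: e_def)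
  obtain c where c: "c \<noteq> 0" "ordered_monomial g N a * g i = c *s ordered_monomial g N (a(i := Suc (a i)))"
    using ordered_monomial_mult_generator[of N g i q a] assms by blast
  have "ordered_monomial g N a * g i = e *s (g i * ordered_monomial g N a)"
    unfolding e_def by (rule ordered_monomial_q_commute) (use assms in auto)
  then have "g i * ordered_monomial g N a = inverse e *s (ordered_monomial g N a * g i)"
    using e by simp
  then show ?thesis using c e by (intro exI[of _ "inverse e * c"]) auto
qed

end

subsection \<open>Commutation of monomials\<close>

lemma mult_antisymmetric_mult:
    "\<lbrakk>mult_antisymmetric n \<Lambda>; i \<in> {1..n}; j \<in> {1..n}\<rbrakk> \<Longrightarrow> \<Lambda> i j * \<Lambda> j i = 1"
  and mult_antisymmetric_diag: "\<lbrakk>mult_antisymmetric n \<Lambda>; i \<in> {1..n}\<rbrakk> \<Longrightarrow> \<Lambda> i i = 1"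
  by (auto simp: mult_antisymmetric_def)

lemma mult_antisymmetric_nonzero:
  "\<lbrakk>mult_antisymmetric n \<Lambda>; i \<in> {1..n}; j \<in> {1..n}\<rbrakk> \<Longrightarrow> \<Lambda> i j \<noteq> 0"
  using mult_antisymmetric_mult by force

text \<open>Exponents are total functions; forcing them to vanish outside the index range lets a
  monomial determine its pair.\<close>

definition weyl_exponents :: "nat \<Rightarrow> nat \<Rightarrow> ((nat \<Rightarrow> nat) \<times> (nat \<Rightarrow> nat)) set" where
  "weyl_exponents n r = {(a, b). (\<forall>j. j \<notin> {1..n} \<longrightarrow> a j = 0) \<and> (\<forall>j. j \<notin> {1..r} \<longrightarrow> b j = 0)}"

lemma sub_skew_field_add:
  assumes "sub_skew_field K" "a \<in> K" "b \<in> K"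
  shows "a + b \<in> K"
proof -
  have "1 - 1 \<in> K" using assms(1) unfolding sub_skew_field_def by blast
  then have "0 - b \<in> K" using assms unfolding sub_skew_field_def by (metis diff_self)
  then have "a - (0 - b) \<in> K" using assms unfolding sub_skew_field_def by blast
  then show ?thesis by simp
qed

text \<open>With \<open>hull_minimal\<close>, this carries commutation from generators to everything
  they generate.\<close>

lemma sub_skew_field_centralizer: "sub_skew_field {v :: 'd::division_ring. v * z = z * v}"
proof -
  have "inverse v * z = z * inverse v" if "v * z = z * v" for v
  proof (cases "v = 0")
    case False
    have "inverse v * z = inverse v * (z * v) * inverse v" using False by (simp add: mult.assoc)
    also have "\<dots> = inverse v * (v * z) * inverse v" by (simp only: that)
    also have "\<dots> = z * inverse v" using False by (simp flip: mult.assoc)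
    finally show ?thesis .
  qed simp
  moreover have "(a * b) * z = z * (a * b)" if "a * z = z * a" "b * z = z * b" for a b
    using that by (metis mult.assoc)
  ultimately show ?thesis
    unfolding sub_skew_field_def by (auto simp: algebra_simps)
qed

text \<open>Only the defining relations, inside an arbitrary division ring: enough for rewriting
  monomials, before anything is known about independence or generation.\<close>

locale weyl_relations = skew_field_algebra scale
  for scale :: "'k::field_char_0 \<Rightarrow> 'd::division_ring \<Rightarrow> 'd" (infixr "*s" 75) +
  fixes n r :: nat and \<Lambda> :: "nat \<Rightarrow> nat \<Rightarrow> 'k" and y x :: "nat \<Rightarrow> 'd"
  assumes r_le_n: "r \<le> n"
    and antisymmetric: "mult_antisymmetric n \<Lambda>"
    and y_y: "\<lbrakk>i \<in> {1..n}; j \<in> {1..n}\<rbrakk> \<Longrightarrow> y i * y j = \<Lambda> i j *s (y j * y i)"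
    and x_y_same: "i \<in> {1..r} \<Longrightarrow> x i * y i = y i * x i + 1"
    and x_y: "\<lbrakk>i \<in> {1..r}; j \<in> {1..n}; i \<noteq> j\<rbrakk> \<Longrightarrow> x i * y j = inverse (\<Lambda> i j) *s (y j * x i)"
    and x_x: "\<lbrakk>i \<in> {1..r}; j \<in> {1..r}\<rbrakk> \<Longrightarrow> x i * x j = \<Lambda> i j *s (x j * x i)"
begin

abbreviation exponents :: "((nat \<Rightarrow> nat) \<times> (nat \<Rightarrow> nat)) set" where
  "exponents \<equiv> weyl_exponents n r"

definition mon :: "(nat \<Rightarrow> nat) \<times> (nat \<Rightarrow> nat) \<Rightarrow> 'd" where
  "mon p = ordered_monomial y n (fst p) * ordered_monomial x r (snd p)"

definition mon_span :: "'d set" where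
  "mon_span = span (mon ` exponents)"

text \<open>The scalar left behind when \<open>y i\<close> crosses a monomial from right to left:
  \<open>y j\<close> contributes \<open>\<Lambda> j i\<close> and \<open>x j\<close> its inverse.
  For \<open>j = i\<close> both are 1, in accordance with the relation between \<open>x i\<close>
  and \<open>y i\<close>.\<close>

definition twist :: "nat \<Rightarrow> (nat \<Rightarrow> nat) \<times> (nat \<Rightarrow> nat) \<Rightarrow> 'k" where
  "twist i p = (\<Prod>j=1..n. \<Lambda> j i ^ fst p j) * (\<Prod>j=1..r. inverse (\<Lambda> j i) ^ snd p j)"

lemmas \<Lambda>_diag = mult_antisymmetric_diag[OF antisymmetric]
  and \<Lambda>_nonzero = mult_antisymmetric_nonzero[OF antisymmetric]

lemma x_range: "i \<in> {1..r} \<Longrightarrow> i \<in> {1..n}"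
  using r_le_n by auto

lemma y_nonzero: "i \<in> {1..r} \<Longrightarrow> y i \<noteq> 0"
  using x_y_same by force

text \<open>The exponents at \<open>i\<close> enter with base \<open>\<Lambda> i i = 1\<close>. So
  the twist survives the diagonal step in \<open>span_mon_of_eigenvector\<close>.\<close>

lemma twist_upd: "i \<in> {1..n} \<Longrightarrow> twist i (a(i := k), b(i := l)) = twist i (a, b)"
  unfolding twist_def by (intro arg_cong2[where f = "(*)"] prod.cong) (auto simp: \<Lambda>_diag)

lemma y_mult_mon:
  assumes "i \<in> {1..n}"
  shows "\<exists>c. c \<noteq> 0 \<and> y i * mon (a, b) = c *s mon (a(i := Suc (a i)), b)"
proof -
  obtain c where "c \<noteq> 0" "y i * ordered_monomial y n a = c *s ordered_monomial y n (a(i := Suc (a i)))"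
    using generator_mult_ordered_monomial[of n y i "\<lambda>j. \<Lambda> j i" a] y_y \<Lambda>_nonzero assms by blast
  then show ?thesis by (auto simp: mon_def simp flip: mult.assoc)
qed

lemma mon_mult_x:
  assumes "i \<in> {1..r}"
  shows "\<exists>c. c \<noteq> 0 \<and> mon (a, b) * x i = c *s mon (a, b(i := Suc (b i)))"
proof -
  obtain c where "c \<noteq> 0" "ordered_monomial x r b * x i = c *s ordered_monomial x r (b(i := Suc (b i)))"
    using ordered_monomial_mult_generator[of r x i "\<lambda>j. \<Lambda> j i" b] x_x \<Lambda>_nonzero x_range assms by blast
  then show ?thesis by (auto simp: mon_def mult.assoc)
qed

text \<open>The Weyl relation differentiates the power. At \<open>k = 0\<close> the truncated
  \<open>k - 1\<close> has coefficient 0.\<close>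

lemma x_power_mult_y: "i \<in> {1..r} \<Longrightarrow> x i ^ k * y i = y i * x i ^ k + of_nat k *s x i ^ (k - 1)"
proof (induction k)
  case (Suc k)
  have "x i ^ Suc k * y i = x i * (x i ^ k * y i)" by (simp add: mult.assoc)
  also have "\<dots> = (x i * y i) * x i ^ k + of_nat k *s (x i * x i ^ (k - 1))"
    by (simp only: Suc.IH[OF Suc.prems] distrib_left mult.assoc scale_mult_right)
  also have "of_nat k *s (x i * x i ^ (k - 1)) = of_nat k *s x i ^ k"
    by (cases k) simp_all
  also have "x i * y i = y i * x i + 1" using Suc.prems by (rule x_y_same)
  finally show ?case
    by (simp add: distrib_right mult.assoc scale_left_distrib add.assoc)
qed simp

text \<open>Only \<open>x i\<close> fails to commute with \<open>y i\<close> up to a scalar, so a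
  single correction arises, a derivative in \<open>x i\<close>. Its coefficient is
  \<open>b i\<close> times a nonzero scalar, hence nonzero in characteristic 0 once
  \<open>b i \<noteq> 0\<close>.\<close>

lemma ordered_x_mult_y:
  assumes "i \<in> {1..n}" "N \<le> r"
  shows "\<exists>\<kappa>. (\<kappa> \<noteq> 0 \<longleftrightarrow> i \<le> N \<and> b i \<noteq> 0) \<and> ordered_monomial x N b * y i
    = (\<Prod>j=1..N. inverse (\<Lambda> j i) ^ b j) *s (y i * ordered_monomial x N b)
      + \<kappa> *s ordered_monomial x N (b(i := b i - 1))"
  using assms(2)
proof (induction N)
  case (Suc N)
  let ?M = "ordered_monomial x N b" and ?e = "\<Prod>j=1..N. inverse (\<Lambda> j i) ^ b j" and ?k = "b (Suc N)"
  obtain \<kappa> where \<kappa>: "\<kappa> \<noteq> 0 \<longleftrightarrow> i \<le> N \<and> b i \<noteq> 0"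
    "?M * y i = ?e *s (y i * ?M) + \<kappa> *s ordered_monomial x N (b(i := b i - 1))"
    using Suc.IH Suc.prems by (meson Suc_leD)
  show ?case
  proof (cases "i = Suc N")
    case True
    have *: "ordered_monomial x N (b(Suc N := b (Suc N) - Suc 0)) = ?M"
      by (rule ordered_monomial_cong) auto
    have "ordered_monomial x (Suc N) b * y i = ?M * (x i ^ ?k * y i)"
      using True by (simp add: mult.assoc)
    also have "\<dots> = (?M * y i) * x i ^ ?k + of_nat ?k *s (?M * x i ^ (?k - 1))"
      using assms Suc.prems True by (simp add: x_power_mult_y distrib_left mult.assoc)
    \<comment> \<open>Here \<open>i\<close> exceeds \<open>N\<close>, so the induction hypothesis
      gives \<open>\<kappa> = 0\<close>.\<close>
    also have "?M * y i = ?e *s (y i * ?M)" using \<kappa> True by auto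
    finally show ?thesis using True assms(1) Suc.prems \<Lambda>_diag[OF assms(1)]
      by (intro exI[of _ "of_nat ?k"])
        (simp del: fun_upd_apply add: mult.assoc * fun_upd_same)
  next
    case False
    have "x (Suc N) * y i = inverse (\<Lambda> (Suc N) i) *s (y i * x (Suc N))"
      using False Suc.prems assms(1) by (intro x_y) auto
    from power_q_commute[OF this, of ?k]
    have "ordered_monomial x (Suc N) b * y i
      = inverse (\<Lambda> (Suc N) i) ^ ?k *s ((?M * y i) * x (Suc N) ^ ?k)"
      by (simp add: mult.assoc)
    also have "\<dots> = (\<Prod>j=1..Suc N. inverse (\<Lambda> j i) ^ b j) *s (y i * ordered_monomial x (Suc N) b)
      + (inverse (\<Lambda> (Suc N) i) ^ ?k * \<kappa>) *s ordered_monomial x (Suc N) (b(i := b i - 1))"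
      using False by (simp add: \<kappa>(2) distrib_right scale_right_distrib mult.assoc mult.commute)
    finally show ?thesis using \<kappa>(1) \<Lambda>_nonzero[of "Suc N" i] Suc.prems r_le_n assms(1) False
      by (intro exI[of _ "inverse (\<Lambda> (Suc N) i) ^ ?k * \<kappa>"] conjI)
        (auto simp del: fun_upd_apply ordered_monomial.simps)
  qed
qed (use assms in auto)

text \<open>The y-part crosses \<open>y i\<close> by scalars alone, so the correction stems from the
  x-part.\<close>

lemma mon_mult_y:
  assumes "i \<in> {1..n}"
  shows "\<exists>\<kappa>. (\<kappa> \<noteq> 0 \<longleftrightarrow> i \<le> r \<and> b i \<noteq> 0) \<and>
    mon (a, b) * y i = twist i (a, b) *s (y i * mon (a, b)) + \<kappa> *s mon (a, b(i := b i - 1))"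
proof -
  obtain \<kappa> where \<kappa>: "\<kappa> \<noteq> 0 \<longleftrightarrow> i \<le> r \<and> b i \<noteq> 0"
    "ordered_monomial x r b * y i = (\<Prod>j=1..r. inverse (\<Lambda> j i) ^ b j) *s (y i * ordered_monomial x r b)
      + \<kappa> *s ordered_monomial x r (b(i := b i - 1))"
    using ordered_x_mult_y[OF assms order_refl, of b] by blast
  have "ordered_monomial y n a * y i = (\<Prod>j=1..n. \<Lambda> j i ^ a j) *s (y i * ordered_monomial y n a)"
    using assms by (intro ordered_monomial_q_commute y_y)
  then have Y: "ordered_monomial y n a * (y i * ordered_monomial x r b)
    = (\<Prod>j=1..n. \<Lambda> j i ^ a j) *s (y i * mon (a, b))"
    by (simp only: mon_def fst_conv snd_conv scale_mult_left flip: mult.assoc)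
  have "mon (a, b) * y i = ordered_monomial y n a * (ordered_monomial x r b * y i)"
    by (simp only: mon_def fst_conv snd_conv mult.assoc)
  also have "\<dots> = (\<Prod>j=1..r. inverse (\<Lambda> j i) ^ b j) *s (ordered_monomial y n a * (y i * ordered_monomial x r b))
      + \<kappa> *s mon (a, b(i := b i - 1))"
    unfolding \<kappa>(2) by (simp only: mon_def fst_conv snd_conv distrib_left scale_mult_right)
  also have "\<dots> = twist i (a, b) *s (y i * mon (a, b)) + \<kappa> *s mon (a, b(i := b i - 1))"
    by (simp only: Y twist_def fst_conv snd_conv scale_scale mult.commute)
  finally show ?thesis using \<kappa>(1) by blast
qed

text \<open>\<open>y i * x i\<close> acts like an Euler operator: it commutes with the generators of
  other index, where two scalars cancel, and has weight 1 on \<open>y i\<close> and -1 on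
  \<open>x i\<close>.\<close>

lemma euler_commutator:
  assumes i: "i \<in> {1..r}"
  shows "y i * x i * mon (a, b)
    = mon (a, b) * (y i * x i) + of_int (int (a i) - int (b i)) * mon (a, b)"
proof -
  let ?w = "y i * x i"
  have in_n: "i \<in> {1..n}" using i by (rule x_range)
  have y: "?w * y j = y j * ?w + of_int (if j = i then 1 else 0) * y j" if j: "j \<in> {1..n}" for j
  proof (cases "j = i")
    case True
    then show ?thesis using x_y_same[OF i] by (simp add: mult.assoc distrib_left)
  next
    case False
    have "?w * y j = inverse (\<Lambda> i j) *s ((y i * y j) * x i)"
      using x_y[OF i j] False by (simp add: mult.assoc)
    also have "\<dots> = y j * ?w" using y_y[OF in_n j] \<Lambda>_nonzero[OF in_n j] by (simp add: mult.assoc)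
    finally show ?thesis using False by simp
  qed
  have x: "?w * x j = x j * ?w + of_int (if j = i then - 1 else 0) * x j" if j: "j \<in> {1..r}" for j
  proof (cases "j = i")
    case True
    have "x i * y i * x i = (y i * x i + 1) * x i" using x_y_same[OF i] by simp
    then show ?thesis using True
      by (simp add: algebra_simps)
  next
    case False
    have jn: "j \<in> {1..n}" using j by (rule x_range)
    have "x j * ?w = inverse (\<Lambda> j i) *s (y i * (x j * x i))"
      using x_y[OF j in_n] False by (simp flip: mult.assoc)
    also have "\<dots> = ?w * x j"
      using x_x[OF j i] \<Lambda>_nonzero[OF jn in_n] by (simp add: mult.assoc)
    finally show ?thesis using False by simp
  qed
  have single: "(\<Sum>j=1..N. (if j = i then c else 0) * int (e j)) = c * int (e i)" if "i \<in> {1..N}" for c N e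
  proof -
    have "(\<Sum>j=1..N. (if j = i then c else 0) * int (e j)) = (\<Sum>j=1..N. if j = i then c * int (e j) else 0)"
      by (rule sum.cong) auto
    then show ?thesis using that by simp
  qed
  have Y: "?w * ordered_monomial y n a = ordered_monomial y n a * ?w + of_int (int (a i)) * ordered_monomial y n a"
    using ordered_monomial_commutator[of n ?w y "\<lambda>j. if j = i then 1 else 0" a, OF y]
    unfolding single[OF in_n] by simp
  have X: "?w * ordered_monomial x r b = ordered_monomial x r b * ?w + of_int (- int (b i)) * ordered_monomial x r b"
    using ordered_monomial_commutator[of r ?w x "\<lambda>j. if j = i then - 1 else 0" b, OF x]
    unfolding single[OF i] by simp
  have "?w * mon (a, b) = (?w * ordered_monomial y n a) * ordered_monomial x r b"
    by (simp only: mon_def fst_conv snd_conv mult.assoc)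
  also have "\<dots> = ordered_monomial y n a * (?w * ordered_monomial x r b) + of_int (int (a i)) *s mon (a, b)"
    unfolding Y by (simp only: distrib_right mon_def fst_conv snd_conv mult.assoc of_int_mult_eq_scale scale_mult_left)
  also have "\<dots> = mon (a, b) * ?w + of_int (- int (b i)) *s mon (a, b) + of_int (int (a i)) *s mon (a, b)"
    unfolding X by (simp only: mon_def fst_conv snd_conv distrib_left mult.assoc of_int_mult_eq_scale scale_mult_right)
  also have "\<dots> = mon (a, b) * ?w + of_int (int (a i) - int (b i)) * mon (a, b)"
    by (simp only: of_int_mult_eq_scale add.assoc flip: scale_left_distrib of_int_add) simp
  finally show ?thesis .
qed

section \<open>The span of the ordered monomials\<close>

lemma linear_image_span:
  assumes "\<And>u v. T (u + v) = T u + T v" "\<And>c u. T (c *s u) = c *s T u"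
    and "\<And>u. u \<in> B \<Longrightarrow> T u \<in> span C" and "f \<in> span B"
  shows "T f \<in> span C"
  using assms(4)
proof (induction rule: span_induct_alt)
  case base
  have "T 0 = 0" using assms(2)[of 0 0] by simp
  then show ?case by (simp add: span_zero)
next
  case (step c u v)
  then show ?case by (simp add: assms span_add span_scale)
qed

lemma mon_span_1: "1 \<in> mon_span"
proof -
  have "mon (\<lambda>_. 0, \<lambda>_. 0) \<in> mon_span"
    unfolding mon_span_def by (rule span_base) (auto simp: weyl_exponents_def)
  then show ?thesis by (simp add: mon_def)
qed

lemma mon_in_mon_span: "p \<in> exponents \<Longrightarrow> mon p \<in> mon_span"
  unfolding mon_span_def by (auto intro: span_base)

lemma mon_span_closed:
  shows "u \<in> mon_span \<Longrightarrow> v \<in> mon_span \<Longrightarrow> u + v \<in> mon_span"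
    and "u \<in> mon_span \<Longrightarrow> c *s u \<in> mon_span"
    and "0 \<in> mon_span"
  unfolding mon_span_def by (auto intro: span_add span_scale span_zero)

lemma y_mult_mon_span:
  assumes i: "i \<in> {1..n}" and u: "u \<in> mon_span"
  shows "y i * u \<in> mon_span"
  unfolding mon_span_def
proof (rule linear_image_span[where T = "\<lambda>u. y i * u"])
  fix u assume "u \<in> mon ` exponents"
  then obtain a b where u: "u = mon (a, b)" "(a, b) \<in> exponents" by auto
  obtain c where "y i * u = c *s mon (a(i := Suc (a i)), b)" using y_mult_mon[OF i] u by blast
  moreover have "(a(i := Suc (a i)), b) \<in> exponents" using u i by (auto simp: weyl_exponents_def)
  ultimately show "y i * u \<in> span (mon ` exponents)" by (simp only: span_scale span_base imageI)
qed (use u in \<open>simp_all add: distrib_left mon_span_def\<close>)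

lemma mon_span_mult_x:
  assumes i: "i \<in> {1..r}" and u: "u \<in> mon_span"
  shows "u * x i \<in> mon_span"
  unfolding mon_span_def
proof (rule linear_image_span[where T = "\<lambda>u. u * x i"])
  fix u assume "u \<in> mon ` exponents"
  then obtain a b where u: "u = mon (a, b)" "(a, b) \<in> exponents" by auto
  obtain c where "u * x i = c *s mon (a, b(i := Suc (b i)))" using mon_mult_x[OF i] u by blast
  moreover have "(a, b(i := Suc (b i))) \<in> exponents" using u i by (auto simp: weyl_exponents_def)
  ultimately show "u * x i \<in> span (mon ` exponents)" by (simp only: span_scale span_base imageI)
qed (use u in \<open>simp_all add: distrib_right mon_span_def\<close>)

lemma mon_span_mult_y:
  assumes i: "i \<in> {1..n}" and u: "u \<in> mon_span"
  shows "u * y i \<in> mon_span"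
  unfolding mon_span_def
proof (rule linear_image_span[where T = "\<lambda>u. u * y i"])
  fix u assume "u \<in> mon ` exponents"
  then obtain a b where u: "u = mon (a, b)" "(a, b) \<in> exponents" by auto
  obtain \<kappa> where "u * y i = twist i (a, b) *s (y i * u) + \<kappa> *s mon (a, b(i := b i - 1))"
    using mon_mult_y[OF i] u by blast
  moreover have "(a, b(i := b i - 1)) \<in> exponents" using u i by (auto simp: weyl_exponents_def)
  moreover have "y i * u \<in> mon_span" using u by (auto intro!: y_mult_mon_span[OF i] mon_in_mon_span)
  ultimately have "u * y i \<in> mon_span" by (simp only: mon_span_closed mon_in_mon_span)
  then show "u * y i \<in> span (mon ` exponents)" by (simp add: mon_span_def)
qed (use u in \<open>simp_all add: distrib_right mon_span_def\<close>)

lemma euler_mon: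
  assumes "i \<in> {1..r}"
  shows "y i * x i * mon p - mon p * (y i * x i) = of_int (int (fst p i) - int (snd p i)) *s mon p"
  by (simp only: euler_commutator[OF assms, of "fst p" "snd p", unfolded prod.collapse]
      of_int_mult_eq_scale add_diff_cancel_left')

text \<open>Left multiplication by \<open>x i\<close> alone has no one-term formula on monomials,
  but this commutator is diagonal.\<close>

lemma euler_mon_span:
  assumes i: "i \<in> {1..r}" and u: "u \<in> mon_span"
  shows "y i * x i * u - u * (y i * x i) \<in> mon_span"
  unfolding mon_span_def
proof (rule linear_image_span[where T = "\<lambda>u. y i * x i * u - u * (y i * x i)"])
  fix u assume "u \<in> mon ` exponents"
  then obtain p where p: "p \<in> exponents" "u = mon p" by blast
  show "y i * x i * u - u * (y i * x i) \<in> span (mon ` exponents)"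
    unfolding p(2) euler_mon[OF i] using p(1) by (intro span_scale span_base imageI)
qed (use u in \<open>simp_all add: mon_span_def distrib_left distrib_right scale_right_diff_distrib\<close>)

end

subsection \<open>Central elements\<close>

text \<open>The two further facts, independence of the monomials and existence of fractions, are
  verified in \<open>weyl_fractions_frac\<close>.\<close>

locale weyl_fractions = weyl_relations scale n r \<Lambda> y x
  for scale :: "'k::field_char_0 \<Rightarrow> 'd::division_ring \<Rightarrow> 'd" (infixr "*s" 75)
    and n r :: nat and \<Lambda> y x +
  assumes mon_independent:
      "\<lbrakk>finite F; F \<subseteq> exponents; (\<Sum>p\<in>F. c p *s mon p) = 0; p \<in> F\<rbrakk> \<Longrightarrow> c p = 0"
    and fractions: "\<exists>u \<in> mon_span. \<exists>v \<in> mon_span. v \<noteq> 0 \<and> d = u * inverse v"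
begin

section \<open>Coefficients with respect to the monomials\<close>

lemma inj_on_mon: "inj_on mon exponents"
proof (rule inj_onI, rule ccontr)
  fix p q assume pq: "p \<in> exponents" "q \<in> exponents" "mon p = mon q" "p \<noteq> q"
  have "(\<Sum>t\<in>{p, q}. (if t = p then 1 else - 1) *s mon t) = 0"
    using pq by simp
  from mon_independent[OF _ _ this, of p] pq show False by simp
qed

lemma independent_mon: "independent (mon ` exponents)"
  unfolding independent_explicit_module
proof (intro allI impI)
  fix t u v assume t: "finite t" "t \<subseteq> mon ` exponents" "(\<Sum>v\<in>t. u v *s v) = 0" "v \<in> t"
  then obtain F where F: "F \<subseteq> exponents" "finite F" "t = mon ` F"
    using finite_subset_image[OF t(1,2)] by blast
  have "(\<Sum>p\<in>F. u (mon p) *s mon p) = 0"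
    using t(3) unfolding F(3) sum.reindex[OF inj_on_subset[OF inj_on_mon F(1)]] by simp
  then show "u v = 0" using mon_independent[OF F(2,1), of "\<lambda>p. u (mon p)"] t(4) F(3) by auto
qed

text \<open>Reindexes \<open>representation\<close> by exponent pairs. Outside the span
  \<open>representation\<close> is zero by default, so linearity holds only on
  \<open>mon_span\<close>.\<close>

definition coeff :: "'d \<Rightarrow> (nat \<Rightarrow> nat) \<times> (nat \<Rightarrow> nat) \<Rightarrow> 'k" where
  "coeff h p = representation (mon ` exponents) h (mon p)"

lemma coeff_mon: "\<lbrakk>p \<in> exponents; q \<in> exponents\<rbrakk> \<Longrightarrow> coeff (mon p) q = (if q = p then 1 else 0)"
  using inj_on_mon unfolding coeff_def
  by (subst representation_basis[OF independent_mon]) (auto dest: inj_onD)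

lemma coeff_add: "\<lbrakk>u \<in> mon_span; v \<in> mon_span\<rbrakk> \<Longrightarrow> coeff (u + v) p = coeff u p + coeff v p"
  and coeff_scale: "u \<in> mon_span \<Longrightarrow> coeff (c *s u) p = c * coeff u p"
  and coeff_0: "coeff 0 p = 0"
  unfolding coeff_def mon_span_def
  by (simp_all add: representation_add[OF independent_mon] representation_scale[OF independent_mon]
      representation_zero)

lemma finite_coeff: "finite {p \<in> exponents. coeff h p \<noteq> 0}"
proof (rule finite_imageD)
  show "finite (mon ` {p \<in> exponents. coeff h p \<noteq> 0})"
    by (rule finite_subset[OF _ finite_representation[of "mon ` exponents" h]]) (auto simp: coeff_def)
qed (rule inj_on_subset[OF inj_on_mon], blast)

lemma mem_span_of_coeff:
  assumes "h \<in> mon_span" "\<And>p. \<lbrakk>p \<in> exponents; coeff h p \<noteq> 0\<rbrakk> \<Longrightarrow> p \<in> P"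
  shows "h \<in> span (mon ` P)"
proof -
  let ?R = "representation (mon ` exponents) h"
  have "v \<in> span (mon ` P)" if v: "?R v \<noteq> 0" for v
  proof -
    obtain p where "p \<in> exponents" "v = mon p" using representation_ne_zero[OF v] by auto
    then show ?thesis using assms(2)[of p] v by (auto simp: coeff_def intro: span_base)
  qed
  then have "(\<Sum>v | ?R v \<noteq> 0. ?R v *s v) \<in> span (mon ` P)" by (auto intro!: span_sum span_scale)
  then show ?thesis
    using sum_nonzero_representation_eq[OF independent_mon] assms(1) by (simp add: mon_span_def)
qed

text \<open>Reduces identities between coefficients to monomials; linearity is assumed on
  \<open>mon_span\<close> only, as that is all \<open>coeff\<close> offers.\<close>

lemma mon_span_functional_eq:
  assumes "\<And>u v. \<lbrakk>u \<in> mon_span; v \<in> mon_span\<rbrakk> \<Longrightarrow> f (u + v) = f u + f v"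
    "\<And>c u. u \<in> mon_span \<Longrightarrow> f (c *s u) = c * f u"
    and "\<And>u v. \<lbrakk>u \<in> mon_span; v \<in> mon_span\<rbrakk> \<Longrightarrow> g (u + v) = g u + g v"
    "\<And>c u. u \<in> mon_span \<Longrightarrow> g (c *s u) = c * g u"
    and "\<And>p. p \<in> exponents \<Longrightarrow> f (mon p) = g (mon p)" and "h \<in> mon_span"
  shows "f h = (g h :: 'k)"
proof -
  have "h \<in> span (mon ` exponents)" using assms(6) by (simp add: mon_span_def)
  then have "h \<in> mon_span \<and> f h = g h"
  proof (induction rule: span_induct_alt)
    case base
    then show ?case using assms(2)[of 0 0] assms(4)[of 0 0] mon_span_closed(3) by simp
  next
    case (step c u v)
    then have "u \<in> mon_span" "f u = g u" using assms(5) by (auto intro: mon_in_mon_span)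
    then show ?case using step.IH by (simp add: assms mon_span_closed)
  qed
  then show ?thesis ..
qed

lemma mon_span_diff: "\<lbrakk>u \<in> mon_span; v \<in> mon_span\<rbrakk> \<Longrightarrow> u - v \<in> mon_span"
  unfolding mon_span_def by (rule span_diff)

text \<open>Two terms of \<open>h\<close> can reach the raised monomial: \<open>(a, b)\<close>
  through multiplication by \<open>y i\<close>, and the one raised in both components through the
  derivative in \<open>x i\<close>. When \<open>a i = 0\<close>, multiplication by
  \<open>y i\<close> cannot produce \<open>(a, b)\<close>, and the derivative alone remains. The
  constants depend neither on \<open>h\<close> nor on \<open>\<mu>\<close>.\<close>

lemma coeff_twisted_commutator:
  assumes i: "i \<in> {1..r}"
  shows "\<exists>s \<kappa>. (\<forall>p. s p \<noteq> 0 \<and> \<kappa> p \<noteq> 0) \<and>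
    (\<forall>h \<in> mon_span. \<forall>\<mu> a b. (a, b) \<in> exponents \<longrightarrow>
      coeff (h * y i - \<mu> *s (y i * h)) (a(i := Suc (a i)), b)
        = (twist i (a, b) - \<mu>) * s (a, b) * coeff h (a, b)
          + \<kappa> (a(i := Suc (a i)), b) * coeff h (a(i := Suc (a i)), b(i := Suc (b i))) \<and>
      (a i = 0 \<longrightarrow>
        coeff (h * y i - \<mu> *s (y i * h)) (a, b) = \<kappa> (a, b) * coeff h (a, b(i := Suc (b i)))))"
proof -
  have in_n: "i \<in> {1..n}" using i by (rule x_range)
  have "\<forall>p. \<exists>c. c \<noteq> 0 \<and> y i * mon p = c *s mon ((fst p)(i := Suc (fst p i)), snd p)"
  proof
    fix p
    show "\<exists>c. c \<noteq> 0 \<and> y i * mon p = c *s mon ((fst p)(i := Suc (fst p i)), snd p)"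
      using y_mult_mon[OF in_n, of "fst p" "snd p"] by (simp only: prod.collapse)
  qed
  from choice[OF this] obtain s where s: "\<And>p. s p \<noteq> 0"
    "\<And>p. y i * mon p = s p *s mon ((fst p)(i := Suc (fst p i)), snd p)"
    by blast
  have "\<forall>p. \<exists>\<kappa>. (\<kappa> \<noteq> 0 \<longleftrightarrow> snd p i \<noteq> 0) \<and>
      mon p * y i = twist i p *s (y i * mon p) + \<kappa> *s mon (fst p, (snd p)(i := snd p i - 1))"
  proof
    fix p
    show "\<exists>\<kappa>. (\<kappa> \<noteq> 0 \<longleftrightarrow> snd p i \<noteq> 0) \<and>
      mon p * y i = twist i p *s (y i * mon p) + \<kappa> *s mon (fst p, (snd p)(i := snd p i - 1))"
      using mon_mult_y[OF in_n, of "snd p" "fst p"] i by (simp only: prod.collapse atLeastAtMost_iff simp_thms)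
  qed
  from choice[OF this] obtain \<kappa> where \<kappa>: "\<And>p. \<kappa> p \<noteq> 0 \<longleftrightarrow> snd p i \<noteq> 0"
    "\<And>p. mon p * y i = twist i p *s (y i * mon p) + \<kappa> p *s mon (fst p, (snd p)(i := snd p i - 1))"
    by blast
  let ?up = "\<lambda>e :: nat \<Rightarrow> nat. e(i := Suc (e i))"
  have T_mon: "mon p * y i - \<mu> *s (y i * mon p)
    = ((twist i p - \<mu>) * s p) *s mon (?up (fst p), snd p)
      + \<kappa> p *s mon (fst p, (snd p)(i := snd p i - 1))" for p \<mu>
    by (simp only: \<kappa>(2) s(2) scale_scale scale_left_diff_distrib left_diff_distrib) simp
  have T_span: "h * y i - \<mu> *s (y i * h) \<in> mon_span" if "h \<in> mon_span" for h \<mu>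
    using that mon_span_mult_y[OF in_n] y_mult_mon_span[OF in_n]
    by (simp add: mon_span_diff mon_span_closed)
  have T_add: "(u + v) * y i - \<mu> *s (y i * (u + v)) = (u * y i - \<mu> *s (y i * u)) + (v * y i - \<mu> *s (y i * v))"
    for u v \<mu> by (simp add: distrib_left distrib_right scale_right_distrib)
  have T_scale: "(c *s u) * y i - \<mu> *s (y i * (c *s u)) = c *s (u * y i - \<mu> *s (y i * u))"
    for c u \<mu> by (simp add: scale_right_diff_distrib mult.commute)
  have exps: "(?up a, b) \<in> exponents" "(a, ?up b) \<in> exponents" "(a, b(i := b i - 1)) \<in> exponents"
    if "(a, b) \<in> exponents" for a b
    using that i in_n by (auto simp: weyl_exponents_def)
  have up_inj: "?up a = ?up a' \<longleftrightarrow> a = a'" for a a' :: "nat \<Rightarrow> nat"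
  proof
    assume eq: "?up a = ?up a'"
    show "a = a'"
    proof
      fix j show "a j = a' j" using fun_cong[OF eq, of j] by (auto split: if_splits)
    qed
  qed simp
  \<comment> \<open>The truncated predecessor inverts \<open>?up\<close> only where
    \<open>b i > 0\<close>; elsewhere \<open>\<kappa>\<close> is zero.\<close>
  have down: "\<kappa> (a, b) = 0 \<or> (b' = b(i := b i - 1) \<longleftrightarrow> ?up b' = b)" for a b b'
  proof (cases "b i = 0")
    case False
    have "b' = b(i := b i - 1) \<longleftrightarrow> ?up b' = b"
    proof
      assume "b' = b(i := b i - 1)" then show "?up b' = b" using False by auto
    next
      assume "?up b' = b" then show "b' = b(i := b i - 1)" by auto
    qed
    then show ?thesis ..
  qed (use \<kappa>(1)[of "(a, b)"] in auto)
  have main: "coeff (h * y i - \<mu> *s (y i * h)) (?up a, b)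
        = (twist i (a, b) - \<mu>) * s (a, b) * coeff h (a, b)
          + \<kappa> (?up a, ?up b) * coeff h (?up a, ?up b)"
    if ab: "(a, b) \<in> exponents" and h: "h \<in> mon_span" for a b h \<mu>
  proof (rule mon_span_functional_eq[where h = h])
    fix p assume p: "p \<in> exponents"
    obtain a' b' where p': "p = (a', b')" by (cases p)
    show "coeff (mon p * y i - \<mu> *s (y i * mon p)) (?up a, b)
        = (twist i (a, b) - \<mu>) * s (a, b) * coeff (mon p) (a, b)
          + \<kappa> (?up a, ?up b) * coeff (mon p) (?up a, ?up b)"
      using p ab exps down[of a' b' b] unfolding T_mon p'
      by (auto simp del: fun_upd_apply simp add: coeff_add coeff_scale coeff_mon mon_span_closed mon_in_mon_span up_inj)
  qed (use h in \<open>simp_all only: T_add T_scale coeff_add coeff_scale T_span mon_span_closed,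
      simp_all del: fun_upd_apply add: algebra_simps\<close>)
  have zero: "coeff (h * y i - \<mu> *s (y i * h)) (a, b) = \<kappa> (a, ?up b) * coeff h (a, ?up b)"
    if ab: "(a, b) \<in> exponents" "a i = 0" and h: "h \<in> mon_span" for a b h \<mu>
  proof (rule mon_span_functional_eq[where h = h])
    fix p assume p: "p \<in> exponents"
    obtain a' b' where p': "p = (a', b')" by (cases p)
    have "a \<noteq> ?up a'" using ab(2) by auto
    then show "coeff (mon p * y i - \<mu> *s (y i * mon p)) (a, b)
        = \<kappa> (a, ?up b) * coeff (mon p) (a, ?up b)"
      using p ab exps down[of a' b' b] unfolding T_mon p'
      by (auto simp del: fun_upd_apply simp add: coeff_add coeff_scale coeff_mon mon_span_closed mon_in_mon_span)
  qed (use h in \<open>simp_all only: T_add T_scale coeff_add coeff_scale T_span mon_span_closed,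
      simp_all del: fun_upd_apply add: algebra_simps\<close>)
  \<comment> \<open>The function supplied for \<open>\<kappa>\<close> is indexed by the target of
    the derivative, one step below its source, and therefore never vanishes.\<close>
  have "\<kappa> (a, ?up b) \<noteq> 0" for a b using \<kappa>(1)[of "(a, ?up b)"] by simp
  then show ?thesis using s(1) main zero
    by (intro exI[of _ s] exI[of _ "\<lambda>p. \<kappa> (fst p, ?up (snd p))"]) (simp del: fun_upd_apply)
qed

lemma coeff_euler:
  assumes i: "i \<in> {1..r}" and h: "h \<in> mon_span" and ab: "(a, b) \<in> exponents"
  shows "coeff (y i * x i * h - h * (y i * x i)) (a, b) = of_int (int (a i) - int (b i)) * coeff h (a, b)"
proof (rule mon_span_functional_eq[where h = h])
  have T_add: "y i * x i * (u + v) - (u + v) * (y i * x i)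
      = (y i * x i * u - u * (y i * x i)) + (y i * x i * v - v * (y i * x i))" for u v
    by (simp add: distrib_left distrib_right)
  have T_scale: "y i * x i * (c *s u) - (c *s u) * (y i * x i) = c *s (y i * x i * u - u * (y i * x i))" for c u
    by (simp add: scale_right_diff_distrib)
  show "coeff (y i * x i * mon p - mon p * (y i * x i)) (a, b)
      = of_int (int (a i) - int (b i)) * coeff (mon p) (a, b)" if "p \<in> exponents" for p
    unfolding euler_mon[OF i] using that ab by (auto simp: coeff_scale coeff_mon mon_in_mon_span)
  show "coeff (y i * x i * (u + v) - (u + v) * (y i * x i)) (a, b)
    = coeff (y i * x i * u - u * (y i * x i)) (a, b) + coeff (y i * x i * v - v * (y i * x i)) (a, b)"
    if "u \<in> mon_span" "v \<in> mon_span" for u v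
    using that by (simp only: T_add coeff_add euler_mon_span[OF i])
  show "coeff (y i * x i * (c *s u) - (c *s u) * (y i * x i)) (a, b)
    = c * coeff (y i * x i * u - u * (y i * x i)) (a, b)" if "u \<in> mon_span" for c u
    using that by (simp only: T_scale coeff_scale euler_mon_span[OF i])
qed (use h in \<open>simp_all add: coeff_add coeff_scale algebra_simps\<close>)

section \<open>Degree in the x_j and twisted eigenvectors\<close>

definition weight :: "(nat \<Rightarrow> nat) \<Rightarrow> nat" where
  "weight b = (\<Sum>j=1..r. b j)"

lemma weight_upd: "i \<in> {1..r} \<Longrightarrow> weight (b(i := k)) + b i = weight b + k"
  unfolding weight_def by (simp add: sum.remove[where x = i])

text \<open>Provides the finiteness needed to bound degrees and to count top terms.\<close>

lemma finite_support_of_span: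
  assumes "f \<in> span (mon ` P)"
  obtains F where "finite F" "F \<subseteq> P" "f \<in> span (mon ` F)"
proof -
  obtain t u where t: "finite t" "t \<subseteq> mon ` P" "f = (\<Sum>v\<in>t. u v *s v)"
    using assms unfolding span_explicit by blast
  obtain F where F: "F \<subseteq> P" "finite F" "t = mon ` F" using finite_subset_image[OF t(1,2)] by blast
  have "f \<in> span (mon ` F)" unfolding t(3) F(3) by (intro span_sum span_scale span_base)
  then show ?thesis using F that by blast
qed

text \<open>Take a term \<open>(a, b)\<close> of maximal x-degree and suppose
  \<open>b i > 0\<close>. At the monomial raised in \<open>y i\<close>, maximality removes the
  derivative and forces the twist to be \<open>\<mu> i\<close>. One diagonal step lower the twist is
  the same, so only the derivative of \<open>(a, b)\<close> remains there, and it is nonzero: a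
  contradiction. Once no \<open>x j\<close> occurs, the Euler equation fixes the
  \<open>a i\<close>.\<close>

lemma span_mon_of_eigenvector:
  assumes h: "h \<in> mon_span"
    and y_eq: "\<And>i. i \<in> {1..r} \<Longrightarrow> h * y i = \<mu> i *s (y i * h)"
    and w_eq: "\<And>i. i \<in> {1..r} \<Longrightarrow> y i * x i * h - h * (y i * x i) = \<delta> i *s h"
  shows "h \<in> span (mon ` {(a, b) \<in> exponents. b = (\<lambda>_. 0) \<and> (\<forall>i \<in> {1..r}. of_nat (a i) = \<delta> i)})"
proof (cases "h = 0")
  case False
  define supp where "supp = {p \<in> exponents. coeff h p \<noteq> 0}"
  have "supp \<noteq> {}"
  proof
    assume "supp = {}"
    then have "h \<in> span (mon ` {})" by (intro mem_span_of_coeff[OF h]) (auto simp: supp_def)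
    then show False using False by simp
  qed
  moreover have "finite supp" unfolding supp_def by (rule finite_coeff)
  ultimately have "Max ((weight \<circ> snd) ` supp) \<in> (weight \<circ> snd) ` supp" by (intro Max_in) auto
  then obtain q where q: "q \<in> supp" "Max ((weight \<circ> snd) ` supp) = weight (snd q)"
    by (auto simp del: Max_in)
  obtain a b where "q = (a, b)" by (cases q)
  with q have ab: "(a, b) \<in> supp" "Max ((weight \<circ> snd) ` supp) = weight b" by simp_all
  have le: "weight (snd q) \<le> weight b" if "q \<in> supp" for q
    using \<open>finite supp\<close> that unfolding ab(2)[symmetric] by (auto intro!: Max_ge)
  have ex: "(a, b) \<in> exponents" and nz: "coeff h (a, b) \<noteq> 0" using ab(1) by (auto simp: supp_def)
  have "b i = 0" if i: "i \<in> {1..r}" for i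
  proof (rule ccontr)
    assume bi: "b i \<noteq> 0"
    let ?a = "a(i := Suc (a i))" and ?b = "b(i := Suc (b i))" and ?b' = "b(i := b i - 1)"
    obtain s \<kappa> where sk: "\<And>p. s p \<noteq> 0" "\<And>p. \<kappa> p \<noteq> 0" and
      up: "\<And>a b. (a, b) \<in> exponents \<Longrightarrow> 0 = (twist i (a, b) - \<mu> i) * s (a, b) * coeff h (a, b)
          + \<kappa> (a(i := Suc (a i)), b) * coeff h (a(i := Suc (a i)), b(i := Suc (b i)))" and
      zero: "\<And>a b. \<lbrakk>(a, b) \<in> exponents; a i = 0\<rbrakk> \<Longrightarrow> 0 = \<kappa> (a, b) * coeff h (a, b(i := Suc (b i)))"
    proof -
      have "h * y i - \<mu> i *s (y i * h) = 0" using y_eq[OF i] by simp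
      then show ?thesis using coeff_twisted_commutator[OF i] h that coeff_0 by metis
    qed
    have "weight b < weight ?b" using weight_upd[OF i, of b "Suc (b i)"] by simp
    then have "(?a, ?b) \<notin> supp" using le[of "(?a, ?b)"] by auto
    then have "coeff h (?a, ?b) = 0" using ex i x_range[OF i] by (auto simp: supp_def weyl_exponents_def)
    then have tw: "twist i (a, b) = \<mu> i" using up[OF ex] sk nz by simp
    have ex': "(a, ?b') \<in> exponents" using ex by (auto simp: weyl_exponents_def)
    have b': "?b'(i := Suc (?b' i)) = b" using bi by auto
    show False
    \<comment> \<open>A diagonal step down requires \<open>a i > 0\<close>; otherwise the second
      formula of \<open>coeff_twisted_commutator\<close> gives the contradiction.\<close>
    proof (cases "a i = 0")
      case True
      then show ?thesis using zero[OF ex'] sk nz unfolding b' by simp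
    next
      case False
      let ?a' = "a(i := a i - 1)"
      have a': "?a'(i := Suc (?a' i)) = a" using False by auto
      have "(?a', ?b') \<in> exponents" using ex by (auto simp: weyl_exponents_def)
      moreover have "twist i (?a', ?b') = \<mu> i" using twist_upd[OF x_range[OF i]] tw by metis
      ultimately show ?thesis using up[of ?a' ?b'] sk nz unfolding b' a' by simp
    qed
  qed
  then have "weight b = 0" by (simp add: weight_def)
  show ?thesis
  proof (rule mem_span_of_coeff[OF h])
    fix p assume p: "p \<in> exponents" "coeff h p \<noteq> 0"
    obtain a b where ab: "p = (a, b)" by (cases p)
    have "weight b = 0" using le[of p] p ab \<open>weight _ = 0\<close> by (simp add: supp_def)
    then have b0: "b j = 0" for j
      using p(1) unfolding ab weyl_exponents_def weight_def by (cases "j \<in> {1..r}") auto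
    have "of_nat (a i) = \<delta> i" if i: "i \<in> {1..r}" for i
      using coeff_euler[OF i h p(1)[unfolded ab]] w_eq[OF i] h p(2) b0 by (simp add: coeff_scale ab)
    then show "p \<in> {(a, b) \<in> exponents. b = (\<lambda>_. 0) \<and> (\<forall>i \<in> {1..r}. of_nat (a i) = \<delta> i)}"
      using p b0 by (auto simp: ab)
  qed
qed (simp add: span_zero)

lemma span_mon_mono: "\<lbrakk>u \<in> span (mon ` P); P \<subseteq> P'\<rbrakk> \<Longrightarrow> u \<in> span (mon ` P')"
  by (rule subsetD[OF span_mono[OF image_mono]])

text \<open>Of the ideal of denominators only its stability under the operators is kept. The
  eigenvalues are read off one fixed top term of a minimal \<open>f\<close>: the operator minus its
  eigenvalue kills that term, so by minimality it kills \<open>f\<close>.\<close>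

lemma exists_eigenvector:
  assumes f0: "f0 \<in> M" "f0 \<noteq> 0" and M: "M \<subseteq> mon_span"
    and y_closed: "\<And>i c f. \<lbrakk>i \<in> {1..r}; f \<in> M\<rbrakk> \<Longrightarrow> f * y i - c *s (y i * f) \<in> M"
    and w_closed: "\<And>i c f. \<lbrakk>i \<in> {1..r}; f \<in> M\<rbrakk> \<Longrightarrow> y i * x i * f - f * (y i * x i) - c *s f \<in> M"
  obtains f \<mu> \<delta> where "f \<in> M" "f \<noteq> 0"
    and "\<And>i. i \<in> {1..r} \<Longrightarrow> f * y i = \<mu> i *s (y i * f)"
    and "\<And>i. i \<in> {1..r} \<Longrightarrow> y i * x i * f - f * (y i * x i) = \<delta> i *s f"
proof -
  define L where "L m = {p \<in> exponents. weight (snd p) < m}" for m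
  define H where "H m = {p \<in> exponents. weight (snd p) = m}" for m
  define P where "P m \<longleftrightarrow> (\<exists>f \<in> M. f \<noteq> 0 \<and> f \<in> span (mon ` L m))" for m
  \<comment> \<open>\<open>A\<close> only bounds the set of top terms, so cancellations need not be
    tracked.\<close>
  define Q where "Q m N \<longleftrightarrow> (\<exists>f \<in> M. \<exists>A. f \<noteq> 0 \<and> finite A \<and> A \<subseteq> H m \<and> card A \<le> N \<and>
    f \<in> span (mon ` (A \<union> L m)))" for m N
  have least: "\<exists>m. R m \<and> (\<forall>k<m. \<not> R k)" if "\<exists>m. R m" for R :: "nat \<Rightarrow> bool"
    using that by (rule exists_least_iff[THEN iffD1])
  have "\<exists>m. P m"
  proof -
    obtain F where F: "finite F" "F \<subseteq> exponents" "f0 \<in> span (mon ` F)"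
      using finite_support_of_span f0(1) M unfolding mon_span_def by blast
    have "p \<in> L (Suc (\<Sum>p\<in>F. weight (snd p)))" if "p \<in> F" for p
      using that F(1,2) member_le_sum[of p F "\<lambda>p. weight (snd p)"] by (auto simp: L_def less_Suc_eq_le)
    then have "f0 \<in> span (mon ` L (Suc (\<Sum>p\<in>F. weight (snd p))))"
      by (intro span_mon_mono[OF F(3)]) blast
    then show ?thesis using f0 by (auto simp: P_def)
  qed
  \<comment> \<open>\<open>L\<close> has a strict bound, so the least \<open>m'\<close> is one more
    than the smallest x-degree of a nonzero element of \<open>M\<close>; it is positive because
    \<open>L 0\<close> is empty.\<close>
  from least[OF this] obtain m' where m': "P m'" "\<And>k. k < m' \<Longrightarrow> \<not> P k" by blast
  have "m' \<noteq> 0"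
  proof
    assume "m' = 0"
    then show False using m'(1) by (auto simp: P_def L_def)
  qed
  then obtain m where m: "m' = Suc m" by (cases m') auto
  have "\<exists>N. Q m N"
  proof -
    obtain f where f: "f \<in> M" "f \<noteq> 0" "f \<in> span (mon ` L (Suc m))" using m'(1) by (auto simp: P_def m)
    obtain F where F: "finite F" "F \<subseteq> L (Suc m)" "f \<in> span (mon ` F)"
      using finite_support_of_span[OF f(3)] by blast
    have "F \<subseteq> (F \<inter> H m) \<union> L m" using F(2) by (auto simp: L_def H_def)
    then have "f \<in> span (mon ` ((F \<inter> H m) \<union> L m))" by (rule span_mon_mono[OF F(3)])
    then have "Q m (card (F \<inter> H m))" unfolding Q_def using f F(1) by blast
    then show ?thesis ..
  qed
  from least[OF this] obtain N where N: "Q m N" "\<And>k. k < N \<Longrightarrow> \<not> Q m k" by blast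
  from N(1) obtain f A where f: "f \<in> M" "f \<noteq> 0" and A: "finite A" "A \<subseteq> H m" "card A \<le> N"
    and fA: "f \<in> span (mon ` (A \<union> L m))" unfolding Q_def by blast
  have "A \<noteq> {}"
  proof
    assume "A = {}"
    then have "P m" using f fA unfolding P_def by auto
    then show False using m'(2) by (simp add: m)
  qed
  then obtain a b where ab: "(a, b) \<in> A" by auto
  \<comment> \<open>\<open>T\<close> is an operator with its eigenvalue at \<open>(a, b)\<close>
    subtracted, and \<open>\<sigma>\<close> is its effect on top exponents. Losing
    \<open>(a, b)\<close> leaves \<open>T f\<close> fewer top monomials than the minimum
    \<open>N\<close>.\<close>
  have vanish: "T f = 0"
    if add: "\<And>u v. T (u + v) = T u + T v" and scale: "\<And>c u. T (c *s u) = c *s T u" and TM: "T f \<in> M"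
      and H: "\<And>p. p \<in> A \<Longrightarrow> \<sigma> p \<in> H m"
      and top: "\<And>p. p \<in> A \<Longrightarrow> T (mon p) \<in> span (mon ` (insert (\<sigma> p) (L m)))"
      and low: "\<And>p. p \<in> insert (a, b) (L m) \<Longrightarrow> T (mon p) \<in> span (mon ` L m)" for T \<sigma>
  proof (rule ccontr)
    assume nz: "T f \<noteq> 0"
    let ?A = "\<sigma> ` (A - {(a, b)})"
    have "T f \<in> span (mon ` (?A \<union> L m))"
    proof (rule linear_image_span[OF add scale _ fA])
      fix u assume "u \<in> mon ` (A \<union> L m)"
      then obtain p where p: "p \<in> A \<union> L m" "u = mon p" by blast
      show "T u \<in> span (mon ` (?A \<union> L m))"
      proof (cases "p \<in> insert (a, b) (L m)")
        case True
        then show ?thesis unfolding p(2) by (rule span_mon_mono[OF low]) simp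
      next
        case False
        then have "T u \<in> span (mon ` (insert (\<sigma> p) (L m)))" using top p by blast
        moreover have "insert (\<sigma> p) (L m) \<subseteq> ?A \<union> L m" using False p by blast
        ultimately show ?thesis by (rule span_mon_mono)
      qed
    qed
    moreover have "card ?A \<le> card (A - {(a, b)})" using A(1) by (intro card_image_le) simp
    moreover have "card (A - {(a, b)}) < card A" using A(1) ab by (intro card_Diff1_less)
    moreover have "finite ?A" "?A \<subseteq> H m" using A(1) H by auto
    ultimately have "Q m (card ?A)" "card ?A < N"
      unfolding Q_def using TM nz A(3) by (blast, linarith)
    then show False using N(2) by blast
  qed
  show ?thesis
  proof (rule that[OF f, of "\<lambda>i. twist i (a, b)" "\<lambda>i. of_int (int (a i) - int (b i))"])
    fix i assume i: "i \<in> {1..r}"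
    have in_n: "i \<in> {1..n}" using i by (rule x_range)
    let ?T = "\<lambda>h. h * y i - twist i (a, b) *s (y i * h)"
    let ?\<sigma> = "\<lambda>p. ((fst p)(i := Suc (fst p i)), snd p)"
    have ex: "?\<sigma> p \<in> exponents" if "p \<in> exponents" for p
      using that in_n by (auto simp: weyl_exponents_def)
    have T: "\<exists>c q. ?T (mon p) = (twist i p - twist i (a, b)) *s c *s mon (?\<sigma> p) + q \<and> q \<in> span (mon ` L m)"
      if p: "p \<in> exponents" "weight (snd p) \<le> m" for p
    proof -
      obtain c where c: "y i * mon p = c *s mon (?\<sigma> p)"
        using y_mult_mon[OF in_n, of "fst p" "snd p"] by (auto simp only: prod.collapse)
      obtain \<kappa> where \<kappa>: "\<kappa> \<noteq> 0 \<longleftrightarrow> i \<le> r \<and> snd p i \<noteq> 0"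
        "mon p * y i = twist i p *s (y i * mon p) + \<kappa> *s mon (fst p, (snd p)(i := snd p i - 1))"
        using mon_mult_y[OF in_n, of "snd p" "fst p"] by (auto simp only: prod.collapse)
      have "?T (mon p) = (twist i p - twist i (a, b)) *s c *s mon (?\<sigma> p)
          + \<kappa> *s mon (fst p, (snd p)(i := snd p i - 1))"
        by (simp only: \<kappa>(2) c scale_left_diff_distrib) simp
      moreover have "\<kappa> *s mon (fst p, (snd p)(i := snd p i - 1)) \<in> span (mon ` L m)"
      proof (cases "snd p i = 0")
        case True
        then show ?thesis using \<kappa>(1) by (simp add: span_zero)
      next
        case False
        have "(fst p, (snd p)(i := snd p i - 1)) \<in> L m"
          using p False weight_upd[OF i, of "snd p" "snd p i - 1"] by (auto simp: L_def weyl_exponents_def)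
        then show ?thesis by (intro span_scale span_base imageI)
      qed
      ultimately show ?thesis by blast
    qed
    have "?T f = 0"
    proof (rule vanish[where \<sigma> = ?\<sigma>])
      show "?T f \<in> M" by (rule y_closed[OF i f(1)])
      show "?\<sigma> p \<in> H m" if "p \<in> A" for p
        using that A(2) ex by (auto simp: H_def)
      show "?T (mon p) \<in> span (mon ` (insert (?\<sigma> p) (L m)))" if "p \<in> A" for p
      proof -
        have "p \<in> exponents" "weight (snd p) \<le> m" using that A(2) by (auto simp: H_def)
        then obtain c q where cq: "?T (mon p) = (twist i p - twist i (a, b)) *s c *s mon (?\<sigma> p) + q"
          "q \<in> span (mon ` L m)" using T by blast
        have "q \<in> span (mon ` (insert (?\<sigma> p) (L m)))"
          by (rule span_mon_mono[OF cq(2)]) blast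
        then show ?thesis unfolding cq(1) by (intro span_add span_scale) (auto intro: span_base)
      qed
      show "?T (mon p) \<in> span (mon ` L m)" if p: "p \<in> insert (a, b) (L m)" for p
      proof -
        have pe: "p \<in> exponents" "weight (snd p) \<le> m" using p ab A(2) by (auto simp: L_def H_def)
        then obtain c q where cq: "?T (mon p) = (twist i p - twist i (a, b)) *s c *s mon (?\<sigma> p) + q"
          "q \<in> span (mon ` L m)" using T by blast
        have "(twist i p - twist i (a, b)) *s c *s mon (?\<sigma> p) \<in> span (mon ` L m)"
        \<comment> \<open>At \<open>(a, b)\<close> the difference of twists vanishes; any other
          \<open>p\<close> already lies in \<open>L m\<close>, and \<open>y i\<close> leaves its
          x-degree alone.\<close>
        proof (cases "p = (a, b)")
          case False
          then have "?\<sigma> p \<in> L m" using p ex by (auto simp: L_def)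
          then show ?thesis by (intro span_scale span_base imageI)
        qed (simp add: span_zero)
        then show ?thesis unfolding cq(1) using cq(2) by (rule span_add)
      qed
    qed (simp_all add: distrib_left distrib_right scale_right_distrib scale_right_diff_distrib mult.commute)
    then show "f * y i = twist i (a, b) *s (y i * f)" by simp
    let ?W = "\<lambda>h. y i * x i * h - h * (y i * x i) - of_int (int (a i) - int (b i)) *s h"
    have W: "?W (mon p) = of_int (int (fst p i) - int (snd p i) - (int (a i) - int (b i))) *s mon p" for p
      by (simp only: euler_mon[OF i] flip: scale_left_diff_distrib of_int_diff)
    have "?W f = 0"
    \<comment> \<open>The Euler commutator is diagonal, so top exponents stay in place.\<close>
    proof (rule vanish[where \<sigma> = id])
      show "?W f \<in> M" by (rule w_closed[OF i f(1)])
      show "?W (mon p) \<in> span (mon ` L m)" if p: "p \<in> insert (a, b) (L m)" for p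
      proof (cases "p = (a, b)")
        case False
        then show ?thesis unfolding W using p by (intro span_scale span_base) auto
      qed (use W[of p] in \<open>simp add: span_zero\<close>)
      show "?W (mon p) \<in> span (mon ` (insert (id p) (L m)))" for p
        unfolding W by (intro span_scale span_base) simp
    qed (use A(2) in \<open>auto simp: distrib_left distrib_right scale_right_distrib scale_right_diff_distrib mult.commute\<close>)
    then show "y i * x i * f - f * (y i * x i) = of_int (int (a i) - int (b i)) *s f" by simp
  qed
qed

section \<open>Skew fields generated by some of the y_j\<close>

definition generated :: "nat set \<Rightarrow> 'd set" where
  "generated J = sub_skew_field hull (range (\<lambda>c. c *s 1) \<union> y ` J)"

lemma sub_skew_field_generated: "sub_skew_field (generated J)"
  unfolding generated_def by (rule sub_skew_field_hull)

lemma scale_1_generated: "c *s 1 \<in> generated J"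
  and y_generated: "j \<in> J \<Longrightarrow> y j \<in> generated J"
  unfolding generated_def by (auto intro: hull_inc)

lemma generated_mult: "\<lbrakk>u \<in> generated J; v \<in> generated J\<rbrakk> \<Longrightarrow> u * v \<in> generated J"
  and generated_add: "\<lbrakk>u \<in> generated J; v \<in> generated J\<rbrakk> \<Longrightarrow> u + v \<in> generated J"
  and generated_1: "1 \<in> generated J"
  and generated_inverse: "u \<in> generated J \<Longrightarrow> inverse u \<in> generated J"
  using sub_skew_field_generated[of J] sub_skew_field_add unfolding sub_skew_field_def by blast+

lemma generated_scale: "u \<in> generated J \<Longrightarrow> c *s u \<in> generated J"
  using generated_mult[OF scale_1_generated[of c J], of u] by simp

lemma generated_power: "u \<in> generated J \<Longrightarrow> u ^ k \<in> generated J"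
  by (induction k) (auto intro: generated_mult generated_1)

lemma generated_mono: "J \<subseteq> J' \<Longrightarrow> generated J \<subseteq> generated J'"
  unfolding generated_def by (rule hull_mono) auto

lemma ordered_monomial_generated:
  assumes "\<And>j. \<lbrakk>j \<in> {1..N}; e j \<noteq> 0\<rbrakk> \<Longrightarrow> j \<in> J"
  shows "ordered_monomial y N e \<in> generated J"
  using assms
proof (induction N)
  case (Suc N)
  then have "y (Suc N) ^ e (Suc N) \<in> generated J"
    by (cases "e (Suc N) = 0") (auto intro: generated_1 generated_power y_generated)
  then show ?case using Suc by (auto intro: generated_mult)
qed (simp add: generated_1)

text \<open>The monomials share the exponents \<open>e\<close> on \<open>y 1\<close>, ...,
  \<open>y r\<close>, and these factors stand leftmost, so they split off as a common left
  factor.\<close>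

lemma factor_generated:
  assumes "h \<in> span (mon ` {(a, b) \<in> exponents. b = (\<lambda>_. 0) \<and> (\<forall>i \<in> {1..r}. a i = e i)})"
  shows "\<exists>g \<in> generated {r+1..n}. h = ordered_monomial y r e * g"
  using assms
proof (induction rule: span_induct_alt)
  case base
  have "0 *s 1 \<in> generated {r+1..n}" by (rule scale_1_generated)
  then show ?case by force
next
  case (step c u v)
  then obtain a where a: "(a, \<lambda>_. 0) \<in> exponents" "\<And>i. i \<in> {1..r} \<Longrightarrow> a i = e i" "u = mon (a, \<lambda>_. 0)"
    by auto
  obtain g where g: "g \<in> generated {r+1..n}" "v = ordered_monomial y r e * g" using step.IH by blast
  let ?a = "\<lambda>j. if j \<le> r then 0 else a j"
  have "ordered_monomial y r a = ordered_monomial y r e" using a(2) by (rule ordered_monomial_cong)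
  then have "u = ordered_monomial y r e * ordered_monomial y n ?a"
    using ordered_monomial_split[OF r_le_n, of y a] a(3) by (simp add: mon_def)
  moreover have "ordered_monomial y n ?a \<in> generated {r+1..n}"
    by (rule ordered_monomial_generated) (auto split: if_splits)
  ultimately show ?case using g
    by (intro bexI[of _ "c *s ordered_monomial y n ?a + g"]) (auto simp: distrib_left intro: generated_add generated_scale)
qed

lemma central_in_generated:
  assumes z: "\<And>v. z * v = v * z"
  shows "z \<in> generated {r+1..n}"
proof -
  \<comment> \<open>The possible denominators of \<open>z\<close>; it contains \<open>v\<close>
    because \<open>z * v = u\<close>.\<close>
  define M where "M = {f \<in> mon_span. z * f \<in> mon_span}"
  obtain u v where uv: "u \<in> mon_span" "v \<in> mon_span" "v \<noteq> 0" "z = u * inverse v" using fractions by blast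
  have "v \<in> M" using uv by (simp add: M_def mult.assoc)
  have w_span: "y i * x i * f - f * (y i * x i) - c *s f \<in> mon_span" if "f \<in> mon_span" "i \<in> {1..r}" for f i c
    using that by (intro mon_span_diff euler_mon_span mon_span_closed(2))
  have y_span: "f * y i - c *s (y i * f) \<in> mon_span" if "f \<in> mon_span" "i \<in> {1..r}" for f i c
    using that mon_span_mult_y y_mult_mon_span x_range by (intro mon_span_diff mon_span_closed) auto
  \<comment> \<open>Since \<open>z\<close> passes through the operators, \<open>M\<close> is stable
    under them, and the equations for \<open>f\<close> carry over to \<open>z * f\<close>.\<close>
  have zy: "z * (f * y i - c *s (y i * f)) = (z * f) * y i - c *s (y i * (z * f))" for f i c
    using z by (simp add: right_diff_distrib) (metis mult.assoc)
  have zw: "z * (y i * x i * f - f * (y i * x i) - c *s f)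
      = y i * x i * (z * f) - (z * f) * (y i * x i) - c *s (z * f)" for f i c
    using z by (simp add: right_diff_distrib) (metis mult.assoc)
  obtain f \<mu> \<delta> where f: "f \<in> M" "f \<noteq> 0"
    and fy: "\<And>i. i \<in> {1..r} \<Longrightarrow> f * y i = \<mu> i *s (y i * f)"
    and fw: "\<And>i. i \<in> {1..r} \<Longrightarrow> y i * x i * f - f * (y i * x i) = \<delta> i *s f"
  proof (rule exists_eigenvector[OF \<open>v \<in> M\<close> \<open>v \<noteq> 0\<close>])
    show "f * y i - c *s (y i * f) \<in> M" if "i \<in> {1..r}" "f \<in> M" for i c f
      using that by (simp add: M_def zy y_span)
    show "y i * x i * f - f * (y i * x i) - c *s f \<in> M" if "i \<in> {1..r}" "f \<in> M" for i c f
      using that by (simp only: M_def zw w_span mem_Collect_eq)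
  qed (auto simp: M_def)
  have g: "z * f \<in> mon_span" "f \<in> mon_span" using f(1) by (auto simp: M_def)
  have gy: "(z * f) * y i = \<mu> i *s (y i * (z * f))" if "i \<in> {1..r}" for i
    using zy[of f i "\<mu> i"] fy[OF that] by simp
  have gw: "y i * x i * (z * f) - (z * f) * (y i * x i) = \<delta> i *s (z * f)" if "i \<in> {1..r}" for i
    using zw[of i f "\<delta> i"] fw[OF that] by simp
  let ?E = "{(a, b) \<in> exponents. b = (\<lambda>_. 0) \<and> (\<forall>i \<in> {1..r}. of_nat (a i) = \<delta> i)}"
  have span: "f \<in> span (mon ` ?E)" "z * f \<in> span (mon ` ?E)"
    using span_mon_of_eigenvector[OF g(2) fy fw] span_mon_of_eigenvector[OF g(1) gy gw] by blast+
  \<comment> \<open>A nonzero \<open>f\<close> has a term, and its exponents realise the scalars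
    \<open>\<delta> i\<close> as natural numbers.\<close>
  have "?E \<noteq> {}"
  proof
    assume "?E = {}"
    with span(1) have "f \<in> span (mon ` {})" by (simp only:)
    then show False using f(2) by simp
  qed
  then obtain e where e: "\<And>i. i \<in> {1..r} \<Longrightarrow> of_nat (e i) = \<delta> i" by blast
  \<comment> \<open>\<open>of_nat\<close> is injective in characteristic 0, so all terms have equal
    exponents on \<open>{1..r}\<close>.\<close>
  have E: "?E = {(a, b) \<in> exponents. b = (\<lambda>_. 0) \<and> (\<forall>i \<in> {1..r}. a i = e i)}"
    using e by (auto simp flip: e)
  obtain f' g' where f': "f' \<in> generated {r+1..n}" "f = ordered_monomial y r e * f'"
    and g': "g' \<in> generated {r+1..n}" "z * f = ordered_monomial y r e * g'"
    using span unfolding E by (blast dest: factor_generated)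
  let ?Y = "ordered_monomial y r e"
  have nz: "?Y \<noteq> 0" "f' \<noteq> 0" using f(2) f'(2) by auto
  \<comment> \<open>Centrality moves \<open>z\<close> to the right of \<open>?Y\<close>, which can
    then be cancelled on the left.\<close>
  have "?Y * (z * f') = ?Y * g'" using z f' g' by (metis mult.assoc)
  then have "z * f' = g'" using nz by simp
  then have "z = g' * inverse f'" using nz by (auto simp: mult.assoc)
  then show ?thesis using f' g' by (simp add: generated_mult generated_inverse)
qed

theorem centre_UNIV_eq: "centre UNIV = centre (generated {1..n}) \<inter> generated {r+1..n}"
proof (intro equalityI subsetI)
  fix z :: 'd assume "z \<in> centre UNIV"
  then have z: "\<And>v. z * v = v * z" by (simp add: centre_def)
  have "z \<in> generated {r+1..n}" using z by (rule central_in_generated)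
  moreover have "generated {r+1..n} \<subseteq> generated {1..n}" by (rule generated_mono) auto
  ultimately show "z \<in> centre (generated {1..n}) \<inter> generated {r+1..n}" using z by (auto simp: centre_def)
next
  fix z assume "z \<in> centre (generated {1..n}) \<inter> generated {r+1..n}"
  then have z: "\<And>v. v \<in> generated {1..n} \<Longrightarrow> v * z = z * v" "z \<in> generated {r+1..n}"
    by (auto simp: centre_def)
  have zy: "y j * z = z * y j" if "j \<in> {1..n}" for j using z(1) y_generated that by blast
  have zx: "x i * z = z * x i" if i: "i \<in> {1..r}" for i
  proof -
    have "generated {r+1..n} \<subseteq> {v. v * (y i * x i) = y i * x i * v}"
      unfolding generated_def
    proof (rule hull_minimal)
      have "y j * (y i * x i) = y i * x i * y j" if j: "j \<in> {r+1..n}" for j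
      proof -
        have ij: "i \<in> {1..n}" "j \<in> {1..n}" "i \<noteq> j" using i j r_le_n by auto
        have "y i * x i * y j = inverse (\<Lambda> i j) *s ((y i * y j) * x i)"
          using x_y[OF i ij(2,3)] by (simp add: mult.assoc)
        also have "\<dots> = y j * (y i * x i)"
          using y_y[OF ij(1,2)] \<Lambda>_nonzero[OF ij(1,2)] by (simp add: mult.assoc)
        finally show ?thesis by (rule sym)
      qed
      then show "range (\<lambda>c. c *s 1) \<union> y ` {r+1..n} \<subseteq> {v. v * (y i * x i) = y i * x i * v}"
        by (intro Un_least image_subsetI) simp_all
    qed (rule sub_skew_field_centralizer)
    then have "z * (y i * x i) = y i * x i * z" using z(2) by blast
    then have "y i * (z * x i) = y i * (x i * z)" using zy[OF x_range[OF i]] by (metis mult.assoc)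
    then show ?thesis using y_nonzero[OF i] by simp
  qed
  have om: "ordered_monomial g N a * z = z * ordered_monomial g N a"
    if "\<And>j. j \<in> {1..N} \<Longrightarrow> g j * z = z * g j" for g N a
    using ordered_monomial_q_commute[of N g z "\<lambda>_. 1" a] by (simp add: that)
  let ?C = "{d. d * z = z * d}"
  have C: "sub_skew_field ?C" by (rule sub_skew_field_centralizer)
  then have C_mult: "u * v \<in> ?C" and C_inverse: "inverse u \<in> ?C" if "u \<in> ?C" "v \<in> ?C" for u v
    using that unfolding sub_skew_field_def by blast+
  have mon: "mon p \<in> ?C" for p
    unfolding mon_def by (intro C_mult) (auto intro!: om zy zx)
  have mon_span: "u \<in> ?C" if u: "u \<in> mon_span" for u
  proof -
    \<comment> \<open>\<open>span {}\<close> is zero, so this says that a linear map vanishing on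
      the monomials vanishes on their span.\<close>
    have "u * z - z * u \<in> span {}"
    proof (rule linear_image_span[where T = "\<lambda>u. u * z - z * u" and B = "mon ` exponents"])
      show "u * z - z * u \<in> span {}" if "u \<in> mon ` exponents" for u
        using that mon by (auto simp: span_zero)
    qed (use u in \<open>simp_all add: mon_span_def distrib_left distrib_right scale_right_diff_distrib\<close>)
    then show ?thesis by simp
  qed
  have "d * z = z * d" for d
  proof -
    obtain u v where uv: "u \<in> mon_span" "v \<in> mon_span" "d = u * inverse v" using fractions by blast
    then have "d \<in> ?C" unfolding uv(3) by (intro C_mult C_inverse mon_span)
    then show ?thesis by simp
  qed
  then show "z \<in> centre UNIV" by (simp add: centre_def)
qed

end

subsection \<open>A faithful representation\<close>

lemma poly_mapping_eq_sum_single: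
  "(p :: 'g \<Rightarrow>\<^sub>0 'k::comm_monoid_add)
    = (\<Sum>w\<in>Poly_Mapping.keys p. Poly_Mapping.single w (Poly_Mapping.lookup p w))"
proof (rule poly_mapping_eqI)
  fix w
  show "Poly_Mapping.lookup p w = Poly_Mapping.lookup
    (\<Sum>w\<in>Poly_Mapping.keys p. Poly_Mapping.single w (Poly_Mapping.lookup p w)) w"
    by (simp add: lookup_sum lookup_single when_def sum.delta in_keys_iff)
qed

section \<open>The action on functions on the lattice\<close>

type_synonym 'k lattice_fun = "(nat \<Rightarrow> int) \<Rightarrow> 'k"

text \<open>The scalar that arises when y_i moves right past the powers of y_1, ..., y_(i-1) to its
  place in the Laurent monomial with exponent \<open>m\<close>. Exponents may be negative, hence
  \<open>powi\<close>.\<close>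

definition q_factor :: "(nat \<Rightarrow> nat \<Rightarrow> 'k::field) \<Rightarrow> nat \<Rightarrow> (nat \<Rightarrow> int) \<Rightarrow> 'k" where
  "q_factor \<Lambda> i m = (\<Prod>j\<in>{1..<i}. \<Lambda> i j powi m j)"

text \<open>With \<open>v\<close> read as the formal sum of v(m) y^m, the coefficient of y_i v at
  \<open>m\<close> comes from the exponent one lower in coordinate \<open>i\<close>.
  \<open>GenX i\<close> multiplies by that coordinate and undoes the shift; reading at
  \<open>m i + 1\<close> explains the factor, and \<open>q_factor\<close> is unaffected, as it
  involves only coordinates below \<open>i\<close>.\<close>

fun act_gen :: "(nat \<Rightarrow> nat \<Rightarrow> 'k::field) \<Rightarrow> weyl_gen \<Rightarrow> 'k lattice_fun \<Rightarrow> 'k lattice_fun" where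
  "act_gen \<Lambda> (GenY i) v m = q_factor \<Lambda> i m * v (m(i := m i - 1))"
| "act_gen \<Lambda> (GenX i) v m = inverse (q_factor \<Lambda> i m) * of_int (m i + 1) * v (m(i := m i + 1))"

primrec act_word :: "(nat \<Rightarrow> nat \<Rightarrow> 'k::field) \<Rightarrow> weyl_gen list \<Rightarrow> 'k lattice_fun \<Rightarrow> 'k lattice_fun" where
  "act_word \<Lambda> [] v = v"
| "act_word \<Lambda> (g # w) v = act_gen \<Lambda> g (act_word \<Lambda> w v)"

definition act :: "(nat \<Rightarrow> nat \<Rightarrow> 'k::field) \<Rightarrow> (weyl_gen list \<Rightarrow>\<^sub>0 'k) \<Rightarrow> 'k lattice_fun \<Rightarrow> 'k lattice_fun" where
  "act \<Lambda> p v m = (\<Sum>w\<in>Poly_Mapping.keys p. Poly_Mapping.lookup p w * act_word \<Lambda> w v m)"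

lemma act_gen_linear:
  "act_gen \<Lambda> g (\<lambda>m. c * u m) = (\<lambda>m. c * act_gen \<Lambda> g u m)"
  "act_gen \<Lambda> g (\<lambda>m. u m + v m) = (\<lambda>m. act_gen \<Lambda> g u m + act_gen \<Lambda> g v m)"
  by (cases g; auto simp: fun_eq_iff algebra_simps)+

lemma act_word_linear:
  "act_word \<Lambda> w (\<lambda>m. c * u m) = (\<lambda>m. c * act_word \<Lambda> w u m)"
  "act_word \<Lambda> w (\<lambda>m. u m + v m) = (\<lambda>m. act_word \<Lambda> w u m + act_word \<Lambda> w v m)"
  by (induction w) (simp_all add: act_gen_linear)

lemma act_word_sum:
  "act_word \<Lambda> w (\<lambda>m. \<Sum>i\<in>I. f i m) = (\<lambda>m. \<Sum>i\<in>I. act_word \<Lambda> w (f i) m)"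
proof (induction I rule: infinite_finite_induct)
  case (insert i I)
  then show ?case using act_word_linear(2)[of \<Lambda> w "f i" "\<lambda>m. \<Sum>i\<in>I. f i m"] by simp
\<comment> \<open>Over an infinite index set the sum is the zero function, preserved by linearity
  with \<open>c = 0\<close>.\<close>
qed (use act_word_linear(1)[of \<Lambda> w 0 "\<lambda>_. 0"] in simp_all)

lemma act_word_append: "act_word \<Lambda> (u @ w) v = act_word \<Lambda> u (act_word \<Lambda> w v)"
  by (induction u) auto

text \<open>Allows sums over the keys of different elements to share one index set.\<close>

lemma act_superset:
  assumes "finite A" "Poly_Mapping.keys p \<subseteq> A"
  shows "act \<Lambda> p v m = (\<Sum>w\<in>A. Poly_Mapping.lookup p w * act_word \<Lambda> w v m)"
  unfolding act_def using assms by (intro sum.mono_neutral_left) (auto simp: in_keys_iff)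

lemma act_add: "act \<Lambda> (p + q) v m = act \<Lambda> p v m + act \<Lambda> q v m"
proof -
  let ?A = "Poly_Mapping.keys p \<union> Poly_Mapping.keys q"
  have "act \<Lambda> (p + q) v m = (\<Sum>w\<in>?A. Poly_Mapping.lookup (p + q) w * act_word \<Lambda> w v m)"
    using keys_add[of p q] by (intro act_superset) auto
  also have "\<dots> = (\<Sum>w\<in>?A. Poly_Mapping.lookup p w * act_word \<Lambda> w v m)
      + (\<Sum>w\<in>?A. Poly_Mapping.lookup q w * act_word \<Lambda> w v m)"
    by (simp add: lookup_add distrib_right sum.distrib)
  also have "\<dots> = act \<Lambda> p v m + act \<Lambda> q v m"
    by (intro arg_cong2[where f = "(+)"] act_superset[symmetric]) auto
  finally show ?thesis .
qed

lemma act_single: "act \<Lambda> (Poly_Mapping.single w c) v m = c * act_word \<Lambda> w v m"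
  using act_superset[of "{w}" "Poly_Mapping.single w c" \<Lambda> v m] by simp

lemma act_0: "act \<Lambda> 0 v m = 0"
  by (simp add: act_def)

lemma act_sum: "act \<Lambda> (\<Sum>i\<in>I. p i) v m = (\<Sum>i\<in>I. act \<Lambda> (p i) v m)"
  by (induction I rule: infinite_finite_induct) (simp_all add: act_add act_0)

lemma act_uminus: "act \<Lambda> (- p) v m = - act \<Lambda> p v m"
  by (metis act_0 act_add add.inverse_unique add_eq_0_iff)

lemma act_diff: "act \<Lambda> (p - q) v m = act \<Lambda> p v m - act \<Lambda> q v m"
  using act_add[of \<Lambda> p "- q" v m] by (simp add: act_uminus)

lemma act_mult: "act \<Lambda> (p * q) v = act \<Lambda> p (act \<Lambda> q v)"
proof
  fix m
  let ?P = "Poly_Mapping.keys p" and ?Q = "Poly_Mapping.keys q"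
  let ?p = "Poly_Mapping.lookup p" and ?q = "Poly_Mapping.lookup q"
  have q: "act \<Lambda> q v = (\<lambda>m. \<Sum>w\<in>?Q. ?q w * act_word \<Lambda> w v m)"
    by (simp add: fun_eq_iff act_def)
  have "p * q = (\<Sum>u\<in>?P. \<Sum>w\<in>?Q. Poly_Mapping.single (u @ w) (?p u * ?q w))"
    by (subst poly_mapping_eq_sum_single[of p], subst poly_mapping_eq_sum_single[of q])
      (simp add: sum_product mult_single plus_list_def)
  then have "act \<Lambda> (p * q) v m = (\<Sum>u\<in>?P. \<Sum>w\<in>?Q. ?p u * ?q w * act_word \<Lambda> (u @ w) v m)"
    by (simp add: act_sum act_single)
  also have "\<dots> = act \<Lambda> p (act \<Lambda> q v) m"
    by (simp add: act_def[of \<Lambda> p] q act_word_sum act_word_linear act_word_append sum_distrib_left mult.assoc)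
  finally show "act \<Lambda> (p * q) v m = act \<Lambda> p (act \<Lambda> q v) m" .
qed

lemma act_letter: "act \<Lambda> (letter g) v = act_gen \<Lambda> g v"
  by (simp add: fun_eq_iff letter_def act_single)

lemma act_scalar: "act \<Lambda> (scalar c) v = (\<lambda>m. c * v m)"
  by (simp add: fun_eq_iff scalar_def act_single)

lemma act_1: "act \<Lambda> 1 v = v"
  using act_scalar[of \<Lambda> 1 v] by (simp add: scalar_1)

lemma q_factor_upd:
  assumes "\<And>j. j \<in> {1..<i} \<Longrightarrow> \<Lambda> i j \<noteq> 0"
  shows "q_factor \<Lambda> i (m(j := m j + t)) = (if j \<in> {1..<i} then \<Lambda> i j powi t else 1) * q_factor \<Lambda> i m"
proof (cases "j \<in> {1..<i}")
  case True
  then show ?thesis using assms[OF True]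
    by (simp add: q_factor_def prod.remove[where x = j] power_int_add)
next
  case False
  then show ?thesis by (auto simp: q_factor_def intro!: prod.cong)
qed

lemma q_factor_nonzero:
  assumes "\<And>j. j \<in> {1..<i} \<Longrightarrow> \<Lambda> i j \<noteq> 0"
  shows "q_factor \<Lambda> i m \<noteq> 0"
  using assms by (auto simp: q_factor_def power_int_eq_0_iff)

definition monomial_word :: "nat \<Rightarrow> nat \<Rightarrow> (nat \<Rightarrow> nat) \<times> (nat \<Rightarrow> nat) \<Rightarrow> weyl_gen list \<Rightarrow>\<^sub>0 'k::field" where
  "monomial_word n r p = ordered_monomial gen_y n (fst p) * ordered_monomial gen_x r (snd p)"

context
  fixes n r :: nat and \<Lambda> :: "nat \<Rightarrow> nat \<Rightarrow> 'k::field_char_0"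
  assumes r_le_n: "r \<le> n" and antisymmetric: "mult_antisymmetric n \<Lambda>"
begin

lemmas antisym_mult = mult_antisymmetric_mult[OF antisymmetric]
  and antisym_diag = mult_antisymmetric_diag[OF antisymmetric]
  and antisym_nonzero = mult_antisymmetric_nonzero[OF antisymmetric]

lemma antisym_inverse: "\<lbrakk>i \<in> {1..n}; j \<in> {1..n}\<rbrakk> \<Longrightarrow> inverse (\<Lambda> i j) = \<Lambda> j i"
  using antisym_mult by (simp add: inverse_unique)

lemma q_factor_up_down:
  assumes "i \<in> {1..n}" "j \<in> {1..n}"
  shows "q_factor \<Lambda> i (m(j := m j + 1)) = (if j < i then \<Lambda> i j else 1) * q_factor \<Lambda> i m"
    and "q_factor \<Lambda> i (m(j := m j - 1)) = (if j < i then \<Lambda> j i else 1) * q_factor \<Lambda> i m"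
proof -
  have nz: "\<And>j. j \<in> {1..<i} \<Longrightarrow> \<Lambda> i j \<noteq> 0" using assms antisym_nonzero by simp
  show "q_factor \<Lambda> i (m(j := m j + 1)) = (if j < i then \<Lambda> i j else 1) * q_factor \<Lambda> i m"
    using q_factor_upd[of i \<Lambda> m j 1, OF nz] assms by simp
  show "q_factor \<Lambda> i (m(j := m j - 1)) = (if j < i then \<Lambda> j i else 1) * q_factor \<Lambda> i m"
    using q_factor_upd[of i \<Lambda> m j "-1", OF nz] assms antisym_inverse[of i j]
    by (simp add: power_int_minus)
qed

lemma q_factor_ne_0: "i \<in> {1..n} \<Longrightarrow> q_factor \<Lambda> i m \<noteq> 0"
  using antisym_nonzero[of i] by (intro q_factor_nonzero) simp

text \<open>For distinct indices the shifts commute, and only the \<open>q_factor\<close> of the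
  larger index feels the shift of the other; this produces the entry of \<open>\<Lambda>\<close>.
  For equal indices \<open>y i * x i\<close> multiplies by \<open>m i\<close> and
  \<open>x i * y i\<close> by \<open>m i + 1\<close>.\<close>

lemma act_relator:
  assumes "p \<in> weyl_relators n r \<Lambda>"
  shows "act \<Lambda> p v m = 0"
proof -
  note simps = act_diff act_add act_mult act_letter act_scalar act_1
  have in_n: "i \<in> {1..n}" if "i \<in> {1..r}" for i using that r_le_n by auto
  have cancel: "\<Lambda> i j * (\<Lambda> j i * c) = c" if "i \<in> {1..n}" "j \<in> {1..n}" for i j c
    using antisym_mult[OF that] by (simp flip: mult.assoc)
  have yy: "act \<Lambda> (gen_y i * gen_y j - scalar (\<Lambda> i j) * gen_y j * gen_y i) v m = 0"
    if ij: "i \<in> {1..n}" "j \<in> {1..n}" for i j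
  proof (cases "i = j")
    case True
    then show ?thesis using ij by (simp add: simps antisym_diag)
  next
    case False
    then show ?thesis using cancel[OF ij] antisym_mult[OF ij]
      by (auto simp: simps q_factor_up_down[OF ij] q_factor_up_down[OF ij(2,1)] fun_upd_twist[of i j])
  qed
  have xx: "act \<Lambda> (gen_x i * gen_x j - scalar (\<Lambda> i j) * gen_x j * gen_x i) v m = 0"
    if "i \<in> {1..r}" "j \<in> {1..r}" for i j
  proof (cases "i = j")
    case True
    then show ?thesis using that in_n by (simp add: simps antisym_diag)
  next
    case False
    note ij = in_n[OF that(1)] in_n[OF that(2)]
    show ?thesis using False cancel[OF ij] antisym_mult[OF ij] antisym_inverse[OF ij] antisym_inverse[OF ij(2,1)]
      by (auto simp: simps q_factor_up_down[OF ij] q_factor_up_down[OF ij(2,1)] fun_upd_twist[of i j])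
  qed
  have xy: "act \<Lambda> (gen_x i * gen_y j - scalar (inverse (\<Lambda> i j)) * gen_y j * gen_x i) v m = 0"
    if "i \<in> {1..r}" and j: "j \<in> {1..n}" and "i \<noteq> j" for i j
  proof -
    note ij = in_n[OF that(1)] j
    show ?thesis using \<open>i \<noteq> j\<close> cancel[OF ij] cancel[OF ij(2,1)] antisym_mult[OF ij]
        antisym_inverse[OF ij] antisym_inverse[OF ij(2,1)]
      by (auto simp: simps q_factor_up_down[OF ij] q_factor_up_down[OF ij(2,1)] fun_upd_twist[of i j])
  qed
  have yx: "act \<Lambda> (gen_x i * gen_y i - (gen_y i * gen_x i + 1)) v m = 0" if "i \<in> {1..r}" for i
  proof -
    note i = in_n[OF that]
    show ?thesis using q_factor_ne_0[OF i]
      by (simp add: simps q_factor_up_down[OF i i]) (simp add: algebra_simps)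
  qed
  show ?thesis using assms yy xx xy yx unfolding weyl_relators_def by blast
qed

text \<open>The annihilator is a two-sided ideal containing the relators, and
  \<open>weyl_ideal\<close> is the smallest one.\<close>

lemma act_weyl_ideal:
  assumes "p \<in> weyl_ideal n r \<Lambda>"
  shows "act \<Lambda> p v m = 0"
proof -
  let ?A = "free_algebra (weyl_gens n r) :: (weyl_gen list \<Rightarrow>\<^sub>0 'k) ring"
  define J where "J = {p \<in> carrier ?A. \<forall>v. act \<Lambda> p v = (\<lambda>_. 0)}"
  interpret ring ?A by (rule ring_free_algebra)
  have act_zero: "act \<Lambda> p (\<lambda>_. 0) = (\<lambda>_. 0)" for p
    by (simp add: fun_eq_iff act_def act_word_linear(1)[of \<Lambda> _ 0 "\<lambda>_. 0", simplified])
  have "ideal J ?A"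
  proof (rule idealI)
    show "subgroup J (add_monoid ?A)"
    proof (rule add.subgroupI)
      show "J \<noteq> {}" using zero_closed by (auto simp: J_def act_0 fun_eq_iff)
      fix p assume p: "p \<in> J"
      then have "\<ominus>\<^bsub>?A\<^esub> p = - p"
        using free_algebra_closed(2)[of p] by (intro minus_equality) (auto simp: J_def)
      then show "\<ominus>\<^bsub>?A\<^esub> p \<in> J"
        using p free_algebra_closed(2)[of p] by (auto simp: J_def fun_eq_iff act_uminus)
    qed (auto simp: J_def fun_eq_iff act_add free_algebra_closed)
  qed (auto simp: J_def act_mult act_zero free_algebra_closed ring_axioms)
  moreover have "weyl_relators n r \<Lambda> \<subseteq> J"
    using weyl_relators_in_free_algebra[OF r_le_n] act_relator by (auto simp: J_def fun_eq_iff)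
  ultimately have "weyl_ideal n r \<Lambda> \<subseteq> J" unfolding weyl_ideal_def by (rule genideal_minimal)
  then show ?thesis using assms by (auto simp: J_def)
qed

section \<open>Independence of the ordered monomials\<close>

lemma act_y_power:
  assumes "i \<in> {1..n}"
  shows "\<exists>c. c \<noteq> 0 \<and> (\<forall>v. act \<Lambda> (gen_y i ^ k) v m = c * v (m(i := m i - int k)))"
proof (induction k arbitrary: m)
  case (Suc k)
  obtain c where "c \<noteq> 0" and c: "\<And>v. act \<Lambda> (gen_y i ^ k) v (m(i := m i - 1)) = c * v (m(i := m i - 1 - int k))"
    using Suc[of "m(i := m i - 1)"] unfolding fun_upd_same fun_upd_upd by blast
  have "m i - 1 - int k = m i - int (Suc k)" by simp
  then have "act \<Lambda> (gen_y i ^ Suc k) v m = q_factor \<Lambda> i m * c * v (m(i := m i - int (Suc k)))" for v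
    by (simp only: power_Suc act_mult act_letter act_gen.simps c mult.assoc)
  moreover have "q_factor \<Lambda> i m * c \<noteq> 0"
    using q_factor_ne_0[OF assms] \<open>c \<noteq> 0\<close> by simp
  ultimately show ?case by blast
qed (auto intro!: exI[of _ 1] simp: act_1)

lemma act_ordered_y:
  assumes "N \<le> n"
  shows "\<exists>c. c \<noteq> 0 \<and> (\<forall>v. act \<Lambda> (ordered_monomial gen_y N a) v m
    = c * v (\<lambda>j. if j \<in> {1..N} then m j - int (a j) else m j))"
  using assms
proof (induction N)
  case (Suc N)
  let ?m = "\<lambda>j. if j \<in> {1..N} then m j - int (a j) else m j"
  obtain c where c: "c \<noteq> 0" "\<And>v. act \<Lambda> (ordered_monomial gen_y N a) v m = c * v ?m"
    using Suc by auto
  obtain c' where c': "c' \<noteq> 0"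
    "\<And>v. act \<Lambda> (gen_y (Suc N) ^ a (Suc N)) v ?m = c' * v (?m(Suc N := ?m (Suc N) - int (a (Suc N))))"
    using act_y_power[of "Suc N" "a (Suc N)" ?m] Suc.prems by auto
  have "?m(Suc N := ?m (Suc N) - int (a (Suc N))) = (\<lambda>j. if j \<in> {1..Suc N} then m j - int (a j) else m j)"
    by (auto simp: fun_eq_iff)
  then have "act \<Lambda> (ordered_monomial gen_y (Suc N) a) v m
      = c * c' * v (\<lambda>j. if j \<in> {1..Suc N} then m j - int (a j) else m j)" for v
    by (simp only: ordered_monomial.simps act_mult c(2) c'(2) mult.assoc)
  then show ?case using c(1) c'(1) by (intro exI[of _ "c * c'"]) simp
qed (auto intro!: exI[of _ 1] simp: act_1)

text \<open>Up to a unit the scalar is (m_i + 1) ... (m_i + k). In characteristic 0 it is nonzero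
  for \<open>m i \<ge> 0\<close>; it contains the factor 0 when the range passes from negative to
  nonnegative.\<close>

lemma act_x_power:
  assumes "i \<in> {1..n}"
  shows "\<exists>c. (0 \<le> m i \<longrightarrow> c \<noteq> 0) \<and> (m i < 0 \<and> 0 \<le> m i + int k \<longrightarrow> c = 0) \<and>
    (\<forall>v. act \<Lambda> (gen_x i ^ k) v m = c * v (m(i := m i + int k)))"
proof (induction k arbitrary: m)
  case (Suc k)
  obtain c where c: "0 \<le> m i + 1 \<Longrightarrow> c \<noteq> 0" "\<lbrakk>m i + 1 < 0; 0 \<le> m i + 1 + int k\<rbrakk> \<Longrightarrow> c = 0"
    "\<And>v. act \<Lambda> (gen_x i ^ k) v (m(i := m i + 1)) = c * v (m(i := m i + 1 + int k))"
    using Suc[of "m(i := m i + 1)"] unfolding fun_upd_same fun_upd_upd by blast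
  let ?c = "inverse (q_factor \<Lambda> i m) * of_int (m i + 1) * c"
  have "?c \<noteq> 0" if "0 \<le> m i"
  proof -
    have "(of_int (m i + 1) :: 'k) \<noteq> 0" using that unfolding of_int_eq_0_iff by linarith
    then show ?thesis using q_factor_ne_0[OF assms, of m] c(1) that by simp
  qed
  moreover have "?c = 0" if "m i < 0" "0 \<le> m i + int (Suc k)"
  \<comment> \<open>Either this step supplies the factor 0, or the passage through 0 lies among the
    remaining \<open>k\<close> steps.\<close>
  proof (cases "m i + 1 = 0")
    case False
    then show ?thesis using c(2) that by simp
  qed (simp only: of_int_0 mult_zero_right mult_zero_left)
  moreover have "act \<Lambda> (gen_x i ^ Suc k) v m = ?c * v (m(i := m i + int (Suc k)))" for v
  proof -
    have "m i + 1 + int k = m i + int (Suc k)" by simp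
    then show ?thesis
      by (simp only: power_Suc act_mult act_letter act_gen.simps c(3) mult.assoc)
  qed
  ultimately show ?case by blast
qed (auto intro!: exI[of _ 1] simp: act_1)

lemma act_ordered_x:
  assumes "N \<le> r"
  shows "\<exists>c. ((\<forall>j \<in> {1..N}. 0 \<le> m j) \<longrightarrow> c \<noteq> 0) \<and>
    ((\<exists>j \<in> {1..N}. m j < 0 \<and> 0 \<le> m j + int (b j)) \<longrightarrow> c = 0) \<and>
    (\<forall>v. act \<Lambda> (ordered_monomial gen_x N b) v m
      = c * v (\<lambda>j. if j \<in> {1..N} then m j + int (b j) else m j))"
  using assms
proof (induction N)
  case (Suc N)
  let ?m = "\<lambda>j. if j \<in> {1..N} then m j + int (b j) else m j"
  obtain c where c: "(\<forall>j \<in> {1..N}. 0 \<le> m j) \<longrightarrow> c \<noteq> 0"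
    "(\<exists>j \<in> {1..N}. m j < 0 \<and> 0 \<le> m j + int (b j)) \<longrightarrow> c = 0"
    "\<And>v. act \<Lambda> (ordered_monomial gen_x N b) v m = c * v ?m"
    using Suc by auto
  obtain c' where c': "0 \<le> m (Suc N) \<longrightarrow> c' \<noteq> 0" "m (Suc N) < 0 \<and> 0 \<le> m (Suc N) + int (b (Suc N)) \<longrightarrow> c' = 0"
    "\<And>v. act \<Lambda> (gen_x (Suc N) ^ b (Suc N)) v ?m = c' * v (?m(Suc N := ?m (Suc N) + int (b (Suc N))))"
    using act_x_power[of "Suc N" ?m "b (Suc N)"] Suc.prems r_le_n by auto
  have "?m(Suc N := ?m (Suc N) + int (b (Suc N))) = (\<lambda>j. if j \<in> {1..Suc N} then m j + int (b j) else m j)"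
    by (auto simp: fun_eq_iff)
  then have "act \<Lambda> (ordered_monomial gen_x (Suc N) b) v m
      = c * c' * v (\<lambda>j. if j \<in> {1..Suc N} then m j + int (b j) else m j)" for v
    by (simp only: ordered_monomial.simps act_mult c(3) c'(3) mult.assoc)
  moreover have "c * c' \<noteq> 0" if "\<forall>j \<in> {1..Suc N}. 0 \<le> m j"
    using that c(1) c'(1) by simp
  moreover have "c * c' = 0" if "\<exists>j \<in> {1..Suc N}. m j < 0 \<and> 0 \<le> m j + int (b j)"
    using that c(2) c'(2) by (auto simp: le_Suc_eq)
  ultimately show ?case by blast
qed (auto intro!: exI[of _ 1] simp: act_1)

text \<open>Evaluating at \<open>a\<^sub>0\<close> the image of the indicator of \<open>b\<^sub>0\<close> makes the monomials triangular.\<close>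

lemma act_monomial_word_indicator:
  fixes v :: "'k lattice_fun"
  assumes "(a0, b0) \<in> weyl_exponents n r" "(a, b) \<in> weyl_exponents n r"
    and v: "v = (\<lambda>m. if m = int \<circ> b0 then 1 else 0)"
  shows "act \<Lambda> (monomial_word n r (a0, b0)) v (int \<circ> a0) \<noteq> 0"
    and "act \<Lambda> (monomial_word n r (a, b)) v (int \<circ> a0) \<noteq> 0 \<Longrightarrow>
      (\<forall>j. b j \<le> b0 j) \<and> (b = b0 \<longrightarrow> a = a0)"
proof -
  have val: "\<exists>c d. c \<noteq> 0 \<and> ((\<forall>j \<in> {1..r}. a j \<le> a0 j) \<longrightarrow> d \<noteq> 0) \<and>
      ((\<exists>j \<in> {1..r}. a0 j < a j \<and> a j \<le> a0 j + b j) \<longrightarrow> d = 0) \<and>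
      act \<Lambda> (monomial_word n r (a, b)) v (int \<circ> a0) =
        c * (d * v (\<lambda>j. int (a0 j) - int (a j) + int (b j)))"
    if ab: "(a, b) \<in> weyl_exponents n r" for a b
  proof -
    let ?m = "\<lambda>j. int (a0 j) - int (a j)"
    have m: "(\<lambda>j. if j \<in> {1..n} then (int \<circ> a0) j - int (a j) else (int \<circ> a0) j) = ?m"
      using ab by (auto simp: fun_eq_iff weyl_exponents_def)
    have m': "(\<lambda>j. if j \<in> {1..r} then ?m j + int (b j) else ?m j) = (\<lambda>j. ?m j + int (b j))"
      using ab by (auto simp: fun_eq_iff weyl_exponents_def)
    obtain c where c: "c \<noteq> 0" "\<And>v. act \<Lambda> (ordered_monomial gen_y n a) v (int \<circ> a0) = c * v ?m"
      using act_ordered_y[of n a "int \<circ> a0"] unfolding m by auto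
    obtain d where d: "(\<forall>j \<in> {1..r}. 0 \<le> ?m j) \<longrightarrow> d \<noteq> 0"
      "(\<exists>j \<in> {1..r}. ?m j < 0 \<and> 0 \<le> ?m j + int (b j)) \<longrightarrow> d = 0"
      "\<And>v. act \<Lambda> (ordered_monomial gen_x r b) v ?m = d * v (\<lambda>j. ?m j + int (b j))"
      using act_ordered_x[of r ?m b] unfolding m' by auto
    have "act \<Lambda> (monomial_word n r (a, b)) v (int \<circ> a0) = c * (d * v (\<lambda>j. ?m j + int (b j)))"
      by (simp only: monomial_word_def fst_conv snd_conv act_mult c(2) d(3))
    moreover have "\<forall>j \<in> {1..r}. 0 \<le> ?m j" if "\<forall>j \<in> {1..r}. a j \<le> a0 j" using that by auto
    moreover have "\<exists>j \<in> {1..r}. ?m j < 0 \<and> 0 \<le> ?m j + int (b j)"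
      if "\<exists>j \<in> {1..r}. a0 j < a j \<and> a j \<le> a0 j + b j" using that by force
    ultimately show ?thesis using c(1) d(1,2) by blast
  qed
  show "act \<Lambda> (monomial_word n r (a0, b0)) v (int \<circ> a0) \<noteq> 0"
    \<comment> \<open>With equal exponents the intermediate point is 0, where the scalar of the
      x-part is nonzero, and the end point is \<open>b0\<close>.\<close>
    using val[OF assms(1)] by (auto simp: v comp_def)
  assume nz: "act \<Lambda> (monomial_word n r (a, b)) v (int \<circ> a0) \<noteq> 0"
  obtain c d where cd: "(\<exists>j \<in> {1..r}. a0 j < a j \<and> a j \<le> a0 j + b j) \<longrightarrow> d = 0"
    "act \<Lambda> (monomial_word n r (a, b)) v (int \<circ> a0) =
        c * (d * v (\<lambda>j. int (a0 j) - int (a j) + int (b j)))"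
    using val[OF assms(2)] by blast
  then have d: "\<not> (\<exists>j \<in> {1..r}. a0 j < a j \<and> a j \<le> a0 j + b j)"
    "v (\<lambda>j. int (a0 j) - int (a j) + int (b j)) \<noteq> 0"
    using nz by (metis mult_zero_left mult_zero_right)+
  then have "(\<lambda>j. int (a0 j) - int (a j) + int (b j)) = int \<circ> b0" by (auto simp: v split: if_splits)
  then have eq: "int (a0 j) - int (a j) + int (b j) = int (b0 j)" for j by (metis comp_apply)
  \<comment> \<open>From a0 - a + b = b0 one gets a \<le> a0 + b for free, so nonvanishing of the
    scalar excludes a0 < a on \<open>{1..r}\<close>; then b - b0 = a - a0 is at most 0.\<close>
  have "b j \<le> b0 j" for j
  proof (cases "j \<in> {1..r}")
    case True
    then have "\<not> (a0 j < a j \<and> a j \<le> a0 j + b j)" using d(1) by blast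
    then show ?thesis using eq[of j] by linarith
  next
    case False
    then show ?thesis using assms(2) by (auto simp: weyl_exponents_def)
  qed
  moreover have "a = a0" if "b = b0"
  proof
    show "a j = a0 j" for j using eq[of j] that by simp
  qed
  ultimately show "(\<forall>j. b j \<le> b0 j) \<and> (b = b0 \<longrightarrow> a = a0)" by blast
qed

text \<open>Test with a term \<open>q\<close> of least x-degree among those with nonzero
  coefficient. Any term detected by its indicator has \<open>b \<le> b0\<close> coordinatewise, so
  \<open>b = b0\<close> by minimality, and then \<open>a = a0\<close>.\<close>

lemma monomial_words_independent:
  assumes F: "finite F" "F \<subseteq> weyl_exponents n r"
    and ideal: "(\<Sum>p\<in>F. scalar (c p) * monomial_word n r p) \<in> weyl_ideal n r \<Lambda>"
    and p: "p \<in> F"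
  shows "c p = 0"
proof (rule ccontr)
  assume "c p \<noteq> 0"
  let ?w = "\<lambda>p :: (nat \<Rightarrow> nat) \<times> (nat \<Rightarrow> nat). \<Sum>j=1..r. snd p j"
  obtain q where q: "q \<in> F" "c q \<noteq> 0" "\<And>p. \<lbrakk>p \<in> F; c p \<noteq> 0\<rbrakk> \<Longrightarrow> ?w q \<le> ?w p"
    using ex_has_least_nat[of "\<lambda>p. p \<in> F \<and> c p \<noteq> 0" p ?w] p \<open>c p \<noteq> 0\<close> by blast
  obtain a0 b0 where ab0: "q = (a0, b0)" by (cases q)
  define v :: "'k lattice_fun" where "v = (\<lambda>m. if m = int \<circ> b0 then 1 else 0)"
  have ex0: "(a0, b0) \<in> weyl_exponents n r" using q(1) F(2) ab0 by blast
  have zero: "c p * act \<Lambda> (monomial_word n r p) v (int \<circ> a0) = 0" if p: "p \<in> F - {q}" for p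
  proof (rule ccontr)
    assume nz: "c p * act \<Lambda> (monomial_word n r p) v (int \<circ> a0) \<noteq> 0"
    obtain a b where ab: "p = (a, b)" by (cases p)
    have ex: "(a, b) \<in> weyl_exponents n r" using p F(2) ab by blast
    have le: "\<And>j. b j \<le> b0 j" and eq: "b = b0 \<Longrightarrow> a = a0"
      using act_monomial_word_indicator(2)[OF ex0 ex v_def] nz ab by auto
    have "?w q \<le> ?w p" using q(3) p nz by auto
    then have sum: "(\<Sum>j=1..r. b0 j) \<le> (\<Sum>j=1..r. b j)" by (simp add: ab ab0)
    have "b j = b0 j" for j
    proof (cases "j \<in> {1..r}")
      case True
      show ?thesis
      proof (rule ccontr)
        assume "b j \<noteq> b0 j"
        then have "b j < b0 j" using le[of j] by simp
        then have "(\<Sum>j=1..r. b j) < (\<Sum>j=1..r. b0 j)"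
          using True le by (intro sum_strict_mono_ex1) auto
        then show False using sum by simp
      qed
    next
      case False
      then show ?thesis using ex ex0 by (auto simp: weyl_exponents_def)
    qed
    then have "b = b0" by blast
    then show False using eq p ab ab0 by blast
  qed
  have rest: "(\<Sum>p\<in>F - {q}. c p * act \<Lambda> (monomial_word n r p) v (int \<circ> a0)) = 0"
    using zero by (rule sum.neutral[OF ballI])
  have "0 = act \<Lambda> (\<Sum>p\<in>F. scalar (c p) * monomial_word n r p) v (int \<circ> a0)"
    using act_weyl_ideal[OF ideal] by simp
  also have "\<dots> = (\<Sum>p\<in>F. c p * act \<Lambda> (monomial_word n r p) v (int \<circ> a0))"
    by (simp add: act_sum act_mult act_scalar)
  also have "\<dots> = c q * act \<Lambda> (monomial_word n r q) v (int \<circ> a0)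
      + (\<Sum>p\<in>F - {q}. c p * act \<Lambda> (monomial_word n r p) v (int \<circ> a0))"
    by (rule sum.remove[OF F(1) q(1)])
  finally show False
    using rest q(2) act_monomial_word_indicator(1)[OF ex0 ex0 v_def] by (simp add: ab0)
qed

end

lemma scalar_mult_commute: "scalar c * p = p * scalar c"
  by (subst (1 2) poly_mapping_eq_sum_single[of p])
    (simp add: scalar_def sum_distrib_left sum_distrib_right mult_single plus_list_def mult.commute)

lemma scalar_add: "scalar (c + d) = scalar c + scalar d"
  and scalar_mult: "scalar (c * d) = scalar c * scalar d"
  by (simp_all add: scalar_def single_add mult_single plus_list_def)

subsection \<open>Fractions of the algebra\<close>

context
  fixes n r :: nat and \<Lambda> :: "nat \<Rightarrow> nat \<Rightarrow> 'k::field_char_0"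
    and \<phi> :: "(weyl_gen list \<Rightarrow>\<^sub>0 'k) set \<Rightarrow> 'd::division_ring"
  assumes r_le_n: "r \<le> n" and antisymmetric: "mult_antisymmetric n \<Lambda>"
    and fractions: "skew_field_of_fractions (weyl_algebra n r \<Lambda>) \<phi>"
begin

abbreviation free_weyl :: "(weyl_gen list \<Rightarrow>\<^sub>0 'k) ring" where
  "free_weyl \<equiv> free_algebra (weyl_gens n r)"

text \<open>Computations use representatives in the free algebra, so the quotient map and
  \<open>\<phi>\<close> are handled as one homomorphism.\<close>

definition frac_of :: "(weyl_gen list \<Rightarrow>\<^sub>0 'k) \<Rightarrow> 'd" where
  "frac_of p = \<phi> (weyl_class n r \<Lambda> p)"

lemma frac_of_hom: "frac_of \<in> ring_hom free_weyl ring_of_type_algebra"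
proof -
  have "(+>\<^bsub>free_weyl\<^esub>) (weyl_ideal n r \<Lambda>) \<in> ring_hom free_weyl (weyl_algebra n r \<Lambda>)"
    unfolding weyl_algebra_def by (rule ideal.rcos_ring_hom[OF ideal_weyl_ideal[OF r_le_n]])
  moreover have "\<phi> \<in> ring_hom (weyl_algebra n r \<Lambda>) ring_of_type_algebra"
    using fractions by (simp add: skew_field_of_fractions_def)
  ultimately have hom: "\<phi> \<circ> (+>\<^bsub>free_weyl\<^esub>) (weyl_ideal n r \<Lambda>) \<in> ring_hom free_weyl ring_of_type_algebra"
    by (rule ring_hom_trans)
  have "\<phi> \<circ> (+>\<^bsub>free_weyl\<^esub>) (weyl_ideal n r \<Lambda>) = frac_of"
    by (simp add: fun_eq_iff frac_of_def weyl_class_def)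
  with hom show ?thesis by simp
qed

lemma frac_of_add: "\<lbrakk>p \<in> carrier free_weyl; q \<in> carrier free_weyl\<rbrakk> \<Longrightarrow> frac_of (p + q) = frac_of p + frac_of q"
  and frac_of_mult: "\<lbrakk>p \<in> carrier free_weyl; q \<in> carrier free_weyl\<rbrakk> \<Longrightarrow> frac_of (p * q) = frac_of p * frac_of q"
  and frac_of_1: "frac_of 1 = 1"
  using ring_hom_add[OF frac_of_hom] ring_hom_mult[OF frac_of_hom] ring_hom_one[OF frac_of_hom]
  by (simp_all add: ring_of_type_algebra_def)

lemma zero_in_free_weyl: "0 \<in> carrier free_weyl"
  by (simp add: carrier_free_algebra)

lemma frac_of_0: "frac_of 0 = 0"
  using frac_of_add[OF zero_in_free_weyl zero_in_free_weyl] by simp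

lemma frac_of_diff:
  assumes "p \<in> carrier free_weyl" "q \<in> carrier free_weyl"
  shows "frac_of (p - q) = frac_of p - frac_of q"
  using frac_of_add[of "p - q" q] assms by (simp add: free_algebra_closed)

text \<open>Injectivity of \<open>\<phi>\<close> identifies the kernel with the defining ideal; this
  transfers independence modulo the ideal to the skew field.\<close>

lemma frac_of_eq_0_iff:
  assumes p: "p \<in> carrier free_weyl"
  shows "frac_of p = 0 \<longleftrightarrow> p \<in> weyl_ideal n r \<Lambda>"
proof -
  interpret I: ideal "weyl_ideal n r \<Lambda>" free_weyl by (rule ideal_weyl_ideal[OF r_le_n])
  have in_quot: "weyl_class n r \<Lambda> q \<in> carrier (weyl_algebra n r \<Lambda>)" if "q \<in> carrier free_weyl" for q
    using ring_hom_closed[OF I.rcos_ring_hom that] by (simp add: weyl_class_def weyl_algebra_def)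
  have "frac_of p = 0 \<longleftrightarrow> frac_of p = frac_of 0" by (simp add: frac_of_0)
  also have "\<dots> \<longleftrightarrow> weyl_class n r \<Lambda> p = weyl_class n r \<Lambda> 0"
    using fractions in_quot[OF p] in_quot[OF zero_in_free_weyl]
    by (auto simp: frac_of_def skew_field_of_fractions_def dest: inj_onD)
  also have "\<dots> \<longleftrightarrow> p \<in> weyl_ideal n r \<Lambda>"
  proof -
    have zero: "weyl_class n r \<Lambda> 0 = weyl_ideal n r \<Lambda>"
      using I.a_coset_add_zero[OF I.a_subset] by (simp add: weyl_class_def)
    have "weyl_class n r \<Lambda> p = weyl_ideal n r \<Lambda>" if "p \<in> weyl_ideal n r \<Lambda>"
      unfolding weyl_class_def using that by (rule I.a_rcos_const)
    moreover have "p \<in> weyl_class n r \<Lambda> p"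
      unfolding weyl_class_def using p by (rule I.a_rcos_self)
    ultimately show ?thesis unfolding zero by blast
  qed
  finally show ?thesis .
qed

lemmas free_weyl_closed = free_algebra_closed[of _ "weyl_gens n r"] scalar_in_free_algebra[of _ "weyl_gens n r"]
  one_in_free_algebra[of "weyl_gens n r"] zero_in_free_weyl

lemma gen_in_free_weyl:
  "i \<in> {1..n} \<Longrightarrow> gen_y i \<in> carrier free_weyl" "i \<in> {1..r} \<Longrightarrow> gen_x i \<in> carrier free_weyl"
  by (simp_all add: letter_in_free_algebra weyl_gens_def)

lemma frac_of_sum:
  assumes "\<And>i. i \<in> I \<Longrightarrow> p i \<in> carrier free_weyl"
  shows "(\<Sum>i\<in>I. p i) \<in> carrier free_weyl \<and> frac_of (\<Sum>i\<in>I. p i) = (\<Sum>i\<in>I. frac_of (p i))"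
  using assms
  by (induction I rule: infinite_finite_induct)
    (simp_all add: free_weyl_closed frac_of_0 frac_of_add)

lemma frac_of_power:
  assumes "p \<in> carrier free_weyl"
  shows "p ^ k \<in> carrier free_weyl \<and> frac_of (p ^ k) = frac_of p ^ k"
  by (induction k) (simp_all add: assms free_weyl_closed frac_of_1 frac_of_mult)

lemma frac_of_ordered_monomial:
  assumes "\<And>i. i \<in> {1..N} \<Longrightarrow> g i \<in> carrier free_weyl"
  shows "ordered_monomial g N a \<in> carrier free_weyl \<and>
    frac_of (ordered_monomial g N a) = ordered_monomial (\<lambda>i. frac_of (g i)) N a"
  using assms
  by (induction N) (simp_all add: free_weyl_closed frac_of_1 frac_of_mult frac_of_power)

text \<open>Scalars commute with the image of the algebra, and centralizers are closed under
  quotients; this makes the image of k central in the division ring.\<close>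

lemma frac_of_scalar_commute: "frac_of (scalar c) * d = d * frac_of (scalar c)"
proof -
  let ?C = "{d. d * frac_of (scalar c) = frac_of (scalar c) * d}"
  have C: "frac_of p \<in> ?C" if "p \<in> carrier free_weyl" for p
    using frac_of_mult[OF that scalar_in_free_algebra, of c] frac_of_mult[OF scalar_in_free_algebra that, of c]
    by (simp add: scalar_mult_commute)
  have "sub_skew_field ?C" by (rule sub_skew_field_centralizer)
  moreover obtain a s where as: "a \<in> carrier (weyl_algebra n r \<Lambda>)" "s \<in> carrier (weyl_algebra n r \<Lambda>)"
    "d = \<phi> a * inverse (\<phi> s)"
    using fractions unfolding skew_field_of_fractions_def by blast
  moreover have "\<phi> a \<in> ?C" if "a \<in> carrier (weyl_algebra n r \<Lambda>)" for a
  proof -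
    obtain p where "p \<in> carrier free_weyl" "a = weyl_class n r \<Lambda> p"
      using \<open>a \<in> carrier _\<close> by (auto simp: weyl_algebra_def FactRing_def A_RCOSETS_def' weyl_class_def)
    then show ?thesis using C by (simp add: frac_of_def)
  qed
  ultimately have "d \<in> ?C" unfolding as(3) sub_skew_field_def by blast
  then show ?thesis by simp
qed

lemma frac_of_relator:
  assumes "p - q \<in> weyl_relators n r \<Lambda>" "p \<in> carrier free_weyl" "q \<in> carrier free_weyl"
  shows "frac_of p = frac_of q"
proof -
  have "p - q \<in> weyl_ideal n r \<Lambda>"
    using assms(1) ring.genideal_self[OF ring_free_algebra weyl_relators_in_free_algebra[OF r_le_n]]
    unfolding weyl_ideal_def by blast
  then show ?thesis
    using assms(2,3) frac_of_eq_0_iff[of "p - q"] by (simp add: frac_of_diff free_weyl_closed)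
qed

section \<open>The skew field of fractions as an instance\<close>

abbreviation frac_scale :: "'k \<Rightarrow> 'd \<Rightarrow> 'd" where
  "frac_scale c d \<equiv> frac_of (scalar c) * d"

lemma weyl_relations_frac:
  "weyl_relations frac_scale n r \<Lambda> (\<lambda>i. frac_of (gen_y i)) (\<lambda>i. frac_of (gen_x i))"
proof unfold_locales
  note closed = free_weyl_closed gen_in_free_weyl
  have in_n: "i \<in> {1..n}" if "i \<in> {1..r}" for i using that r_le_n by auto
  fix i j
  show "frac_of (gen_y i) * frac_of (gen_y j) = frac_scale (\<Lambda> i j) (frac_of (gen_y j) * frac_of (gen_y i))"
    if ij: "i \<in> {1..n}" "j \<in> {1..n}"
  proof -
    have "frac_of (gen_y i * gen_y j) = frac_of (scalar (\<Lambda> i j) * gen_y j * gen_y i)"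
      using ij by (intro frac_of_relator closed) (unfold weyl_relators_def, blast | simp)+
    then show ?thesis using ij by (simp add: frac_of_mult closed mult.assoc)
  qed
  show "frac_of (gen_x i) * frac_of (gen_y i) = frac_of (gen_y i) * frac_of (gen_x i) + 1"
    if i: "i \<in> {1..r}"
  proof -
    have "frac_of (gen_x i * gen_y i) = frac_of (gen_y i * gen_x i + 1)"
      using i in_n[OF i] by (intro frac_of_relator closed) (unfold weyl_relators_def, blast | simp)+
    then show ?thesis using i in_n[OF i] by (simp add: frac_of_mult frac_of_add frac_of_1 closed)
  qed
  show "frac_of (gen_x i) * frac_of (gen_y j)
      = frac_scale (inverse (\<Lambda> i j)) (frac_of (gen_y j) * frac_of (gen_x i))"
    if ij: "i \<in> {1..r}" "j \<in> {1..n}" "i \<noteq> j"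
  proof -
    have "frac_of (gen_x i * gen_y j) = frac_of (scalar (inverse (\<Lambda> i j)) * gen_y j * gen_x i)"
      using ij by (intro frac_of_relator closed) (unfold weyl_relators_def, blast | simp)+
    then show ?thesis using ij by (simp add: frac_of_mult closed mult.assoc)
  qed
  show "frac_of (gen_x i) * frac_of (gen_x j) = frac_scale (\<Lambda> i j) (frac_of (gen_x j) * frac_of (gen_x i))"
    if ij: "i \<in> {1..r}" "j \<in> {1..r}"
  proof -
    have "frac_of (gen_x i * gen_x j) = frac_of (scalar (\<Lambda> i j) * gen_x j * gen_x i)"
      using ij by (intro frac_of_relator closed) (unfold weyl_relators_def, blast | simp)+
    then show ?thesis using ij by (simp add: frac_of_mult closed mult.assoc)
  qed
  fix c d u v
  show "frac_scale c (u + v) = frac_scale c u + frac_scale c v" by (rule distrib_left)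
  show "frac_scale (c + d) u = frac_scale c u + frac_scale d u"
    by (simp add: scalar_add frac_of_add closed distrib_right)
  show "frac_scale c (frac_scale d u) = frac_scale (c * d) u"
    by (simp add: scalar_mult frac_of_mult closed mult.assoc)
  show "frac_scale 1 u = u" by (simp add: scalar_1 frac_of_1)
  show "frac_scale c u * v = frac_scale c (u * v)" by (rule mult.assoc)
  show "u * frac_scale c v = frac_scale c (u * v)"
    using frac_of_scalar_commute[of c u] by (simp flip: mult.assoc)
qed (rule r_le_n, rule antisymmetric)

interpretation relations: weyl_relations frac_scale n r \<Lambda> "\<lambda>i. frac_of (gen_y i)" "\<lambda>i. frac_of (gen_x i)"
  by (rule weyl_relations_frac)

lemma frac_of_monomial_word:
  "monomial_word n r p \<in> carrier free_weyl \<and> frac_of (monomial_word n r p) = relations.mon p"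
  unfolding monomial_word_def relations.mon_def
  using frac_of_ordered_monomial[of n gen_y "fst p"] frac_of_ordered_monomial[of r gen_x "snd p"]
    gen_in_free_weyl by (simp add: free_weyl_closed frac_of_mult)

text \<open>Letters are appended at the right end because \<open>mon_span\<close> is closed under
  right multiplication by the generators.\<close>

lemma frac_of_word_in_mon_span:
  "set w \<subseteq> weyl_gens n r \<Longrightarrow> Poly_Mapping.single w 1 \<in> carrier free_weyl \<and>
    frac_of (Poly_Mapping.single w 1) \<in> relations.mon_span"
proof (induction w rule: rev_induct)
  case Nil
  have "Poly_Mapping.single [] 1 = (1 :: weyl_gen list \<Rightarrow>\<^sub>0 'k)" by (simp flip: scalar_1 scalar_def)
  then show ?case by (simp add: free_weyl_closed frac_of_1 relations.mon_span_1)
next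
  case (snoc g w)
  then have g: "g \<in> weyl_gens n r" and w: "Poly_Mapping.single w 1 \<in> carrier free_weyl"
    "frac_of (Poly_Mapping.single w 1) \<in> relations.mon_span" by auto
  have eq: "Poly_Mapping.single (w @ [g]) 1 = Poly_Mapping.single w 1 * (letter g :: weyl_gen list \<Rightarrow>\<^sub>0 'k)"
    by (simp add: letter_def mult_single plus_list_def)
  have "frac_of (Poly_Mapping.single w 1) * frac_of (letter g) \<in> relations.mon_span"
    using g w(2) by (auto simp: weyl_gens_def intro!: relations.mon_span_mult_x relations.mon_span_mult_y)
  then show ?case
    unfolding eq using g w(1) by (simp add: frac_of_mult free_weyl_closed letter_in_free_algebra)
qed

lemma frac_of_in_mon_span:
  assumes p: "p \<in> carrier free_weyl"
  shows "frac_of p \<in> relations.mon_span"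
proof -
  let ?t = "\<lambda>w. scalar (Poly_Mapping.lookup p w) * Poly_Mapping.single w 1"
  have w: "Poly_Mapping.single w 1 \<in> carrier free_weyl" "frac_of (Poly_Mapping.single w 1) \<in> relations.mon_span"
    if "w \<in> Poly_Mapping.keys p" for w
    using frac_of_word_in_mon_span[of w] that p by (auto simp: carrier_free_algebra)
  have p_eq: "p = (\<Sum>w\<in>Poly_Mapping.keys p. ?t w)"
    by (subst poly_mapping_eq_sum_single) (simp add: scalar_def mult_single plus_list_def)
  have "frac_of p = (\<Sum>w\<in>Poly_Mapping.keys p. frac_of (?t w))"
    by (subst p_eq, rule conjunct2[OF frac_of_sum]) (simp add: w free_weyl_closed)
  also have "\<dots> = (\<Sum>w\<in>Poly_Mapping.keys p. frac_scale (Poly_Mapping.lookup p w) (frac_of (Poly_Mapping.single w 1)))"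
    by (intro sum.cong frac_of_mult) (simp_all add: w free_weyl_closed)
  also have "\<dots> \<in> relations.mon_span"
    using w(2) unfolding relations.mon_span_def by (intro relations.span_sum relations.span_scale)
  finally show ?thesis .
qed

lemma weyl_fractions_frac:
  "weyl_fractions frac_scale n r \<Lambda> (\<lambda>i. frac_of (gen_y i)) (\<lambda>i. frac_of (gen_x i))"
proof unfold_locales
  fix F c p assume F: "finite F" "F \<subseteq> relations.exponents"
    and sum: "(\<Sum>p\<in>F. frac_scale (c p) (relations.mon p)) = 0" and p: "p \<in> F"
  let ?P = "\<Sum>p\<in>F. scalar (c p) * monomial_word n r p"
  have closed: "scalar (c p) * monomial_word n r p \<in> carrier free_weyl" for p
    using frac_of_monomial_word by (simp add: free_weyl_closed)
  have "frac_of ?P = (\<Sum>p\<in>F. frac_scale (c p) (relations.mon p))"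
    using frac_of_sum[of F "\<lambda>p. scalar (c p) * monomial_word n r p"] closed frac_of_monomial_word
    by (simp add: frac_of_mult free_weyl_closed)
  then have "?P \<in> weyl_ideal n r \<Lambda>"
    using sum frac_of_eq_0_iff[of ?P] frac_of_sum[of F "\<lambda>p. scalar (c p) * monomial_word n r p"] closed by simp
  then show "c p = 0"
    using monomial_words_independent[OF r_le_n antisymmetric F(1) _ _ p] F(2) by blast
next
  fix d
  obtain a s where as: "a \<in> carrier (weyl_algebra n r \<Lambda>)" "s \<in> carrier (weyl_algebra n r \<Lambda>)"
    "s \<noteq> \<zero>\<^bsub>weyl_algebra n r \<Lambda>\<^esub>" "d = \<phi> a * inverse (\<phi> s)"
    using fractions unfolding skew_field_of_fractions_def by blast
  obtain p q where pq: "p \<in> carrier free_weyl" "a = weyl_class n r \<Lambda> p"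
    "q \<in> carrier free_weyl" "s = weyl_class n r \<Lambda> q"
    using as(1,2) by (auto simp: weyl_algebra_def FactRing_def A_RCOSETS_def' weyl_class_def)
  show "\<exists>u \<in> relations.mon_span. \<exists>v \<in> relations.mon_span. v \<noteq> 0 \<and> d = u * inverse v"
  \<comment> \<open>With \<open>inverse 0 = 0\<close>, a vanishing denominator would give the
    element 0, which is 0 over 1.\<close>
  proof (cases "frac_of q = 0")
    case True
    then have "d = 0 * inverse 1" using as(4) pq by (simp add: frac_of_def)
    then show ?thesis using relations.mon_span_1 relations.mon_span_closed(3) zero_neq_one by metis
  next
    case False
    then show ?thesis using as(4) pq frac_of_in_mon_span by (auto simp: frac_of_def)
  qed
qed

lemma centre_skew_field_of_fractions:
  "centre (UNIV :: 'd set) = centre (y_subfield n r \<Lambda> \<phi> {1..n}) \<inter> y_subfield n r \<Lambda> \<phi> {r+1..n}"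
proof -
  interpret fracs: weyl_fractions frac_scale n r \<Lambda> "\<lambda>i. frac_of (gen_y i)" "\<lambda>i. frac_of (gen_x i)"
    by (rule weyl_fractions_frac)
  \<comment> \<open>The scalar multiple of 1 by \<open>c\<close> is the image of the class of
    \<open>scalar c\<close>, so both hulls have the same generators.\<close>
  have "fracs.generated J = y_subfield n r \<Lambda> \<phi> J" for J
    by (simp add: fracs.generated_def y_subfield_def flip: frac_of_def)
  then show ?thesis using fracs.centre_UNIV_eq by simp
qed

end

theorem proposition3p3p1:
  fixes n r :: nat
    and \<Lambda> :: "nat \<Rightarrow> nat \<Rightarrow> 'k::field_char_0"
    and \<phi> :: "(weyl_gen list \<Rightarrow>\<^sub>0 'k) set \<Rightarrow> 'd::division_ring"
  assumes "n \<ge> 1" and "r \<le> n"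
    and "mult_antisymmetric n \<Lambda>"
    and "skew_field_of_fractions (weyl_algebra n r \<Lambda>) \<phi>"
  shows "centre (UNIV :: 'd set) =
    centre (y_subfield n r \<Lambda> \<phi> {1..n}) \<inter> y_subfield n r \<Lambda> \<phi> {r+1..n}"
  using assms(2-4) by (rule centre_skew_field_of_fractions)

end
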